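(* Let $\alpha,\beta>0$ with $\alpha+\beta<1$. Assume that $p>cn$ for some constant $c>0$ not depending on $n,p$, and $p=\exp(o(n^\gamma))$ with $\gamma=\min(1-\epsilon,\frac2\tau-1)$ for some $\epsilon>0$, where $0<\tau<2$ is a fixed constant. Then for any $0<\delta<2$, $$\limsup_{(n,p)\to\infty}\ \sup_{T_\alpha\in\mathcal T_\alpha}\ \inf_{\boldsymbol\Psi\in\mathcal F(\delta)}\mathbb P(T_\alpha=1)\le1-\beta,$$ where the probability is computed under $\mathbf X\sim N(\boldsymbol\mu\mathbf 1',\boldsymbol\Sigma\otimes\boldsymbol\Psi)$.
   Context: Setting: $p=p_n$. The $p\times n$ data matrix $\mathbf X=(\boldsymbol X_1,\ldots,\boldsymbol X_n)$ with columns $\boldsymbol X_i=(X_{i1},\ldots,X_{ip})'$ is matrix-variate normal, $\mathbf X\sim N(\boldsymbol\mu\mathbf 1',\boldsymbol\Sigma\otimes\boldsymbol\Psi)$, meaning $\mathrm{vec}(\mathbf X')\sim N(\mathrm{vec}(\mathbf 1\boldsymbol\mu'),\boldsymbol\Sigma\otimes\boldsymbol\Psi)$; equivalently the $X_{ik}$ are jointly Gaussian with $\mathbb E X_{ik}=\mu_k$ and $\mathrm{Cov}(X_{ik},X_{jl})=\psi_{ij}\sigma_{kl}$, where $\boldsymbol\Sigma=(\sigma_{kl})_{p\times p}$ and $\boldsymbol\Psi=(\psi_{ij})_{n\times n}$ are covariance matrices with $\psi_{ii}=1$ for all $i$. The null hypothesis is $H_0:\psi_{ij}=0$ for all $1\le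 i<j\le n$. $\mathcal T_\alpha=\{T_\alpha:\mathbb P(T_\alpha=1\mid H_0)\le\alpha\}$ is the set of $\alpha$-level tests of $H_0$ based on $\mathbf X$ when $\boldsymbol\mu$ and $\boldsymbol\Sigma$ are known (so tests may depend on $\boldsymbol\mu,\boldsymbol\Sigma$); $T_\alpha=1$ means rejection of $H_0$. For $1\le i<j\le n$, $$d_{ij,\boldsymbol\Psi}=\psi_{ij}-\frac{\sum_{k\ne i}\psi_{ik}}{n}-\frac{\sum_{k\ne j}\psi_{jk}}{n}-\frac{\sum_{1\le k\ne l\le n}\psi_{kl}}{n^2(n-1)},\qquad d_{n,\boldsymbol\Psi}=\max_{1\le i<j\le n}|d_{ij,\boldsymbol\Psi}|,$$ and for $\delta>0$ $$\mathcal F(\delta)=\Big\{\boldsymbol\Psi\succ0:\ \psi_{ii}=1,\ 1\le i\le n,\ \text{and } d_{n,\boldsymbol\Psi}\ge\delta\sqrt{\tfrac{\log n}{p}}\Big\}.$$ *)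

theory Defs
  imports
    "HOL-Probability.Probability"
    "HOL-Library.Landau_Symbols"
    "Jordan_Normal_Form.Matrix"
begin

text \<open>Matrices and vectors are those of Jordan_Normal_Form, so all indices start at 0.\<close>

definition covariance_mat :: "nat \<Rightarrow> real mat \<Rightarrow> bool" where
  "covariance_mat m A \<longleftrightarrow>
     A \<in> carrier_mat m m \<and> transpose_mat A = A \<and>
     (\<forall>v\<in>carrier_vec m. v \<bullet> (A *\<^sub>v v) \<ge> 0)"

definition positive_definite_mat :: "nat \<Rightarrow> real mat \<Rightarrow> bool" where
  "positive_definite_mat m A \<longleftrightarrow>
     A \<in> carrier_mat m m \<and> transpose_mat A = A \<and>
     (\<forall>v\<in>carrier_vec m. v \<noteq> 0\<^sub>v m \<longrightarrow> v \<bullet> (A *\<^sub>v v) > 0)"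

text \<open>The univariate law \<open>N(m, v)\<close> with variance \<open>v \<ge> 0\<close>; variance 0 gives a point mass.
  (The library's normal_density takes the standard deviation.)\<close>

definition normal_law :: "real \<Rightarrow> real \<Rightarrow> real measure" where
  "normal_law m v =
     (if v = 0 then return borel m
      else density lborel (\<lambda>x. ennreal (normal_density m (sqrt v) x)))"

text \<open>\<open>M\<close> is the law of a jointly Gaussian family indexed by the finite set \<open>I\<close>, with mean \<open>m\<close>
  and covariance \<open>K\<close>: every linear combination of the coordinates is normal, with the mean and
  variance determined by \<open>m\<close> and \<open>K\<close>. The covariance may be singular.\<close>

definition is_gaussian_law ::
  "'i set \<Rightarrow> ('i \<Rightarrow> real) \<Rightarrow> ('i \<Rightarrow> 'i \<Rightarrow> real) \<Rightarrow> ('i \<Rightarrow> real) measure \<Rightarrow> bool" where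
  "is_gaussian_law I m K M \<longleftrightarrow>
     prob_space M \<and> sets M = sets (\<Pi>\<^sub>M i\<in>I. borel) \<and>
     (\<forall>a. distr M borel (\<lambda>x. \<Sum>i\<in>I. a i * x i) =
        normal_law (\<Sum>i\<in>I. a i * m i) (\<Sum>i\<in>I. \<Sum>j\<in>I. a i * a j * K i j))"

text \<open>For finite \<open>I\<close> and symmetric positive semidefinite \<open>K\<close> there is exactly one such law
  (uniqueness is the Cramer-Wold theorem).\<close>

definition gaussian_law ::
  "'i set \<Rightarrow> ('i \<Rightarrow> real) \<Rightarrow> ('i \<Rightarrow> 'i \<Rightarrow> real) \<Rightarrow> ('i \<Rightarrow> real) measure" where
  "gaussian_law I m K = (THE M. is_gaussian_law I m K M)"

text \<open>A \<open>p \<times> n\<close> data matrix is stored as a function of the pairs \<open>(i, k)\<close>, where \<open>i < n\<close> is the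
  observation (the column) and \<open>k < p\<close> the variable (the row); its value at \<open>(i, k)\<close> is \<open>X\<^sub>i\<^sub>k\<close>.\<close>

definition data_space :: "nat \<Rightarrow> nat \<Rightarrow> (nat \<times> nat \<Rightarrow> real) measure" where
  "data_space n p = (\<Pi>\<^sub>M ik\<in>{..<n} \<times> {..<p}. borel)"

definition matrix_normal ::
  "nat \<Rightarrow> nat \<Rightarrow> real vec \<Rightarrow> real mat \<Rightarrow> real mat \<Rightarrow> (nat \<times> nat \<Rightarrow> real) measure" where
  "matrix_normal n p \<mu> \<Sigma> \<Psi> =
     gaussian_law ({..<n} \<times> {..<p})
       (\<lambda>(i, k). \<mu> $ k)
       (\<lambda>(i, k) (j, l). \<Psi> $$ (i, j) * \<Sigma> $$ (k, l))"

definition rejection_prob ::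
  "nat \<Rightarrow> nat \<Rightarrow> real vec \<Rightarrow> real mat \<Rightarrow> real mat \<Rightarrow> ((nat \<times> nat \<Rightarrow> real) \<Rightarrow> nat) \<Rightarrow> real" where
  "rejection_prob n p \<mu> \<Sigma> \<Psi> T =
     measure (matrix_normal n p \<mu> \<Sigma> \<Psi>) {X \<in> space (data_space n p). T X = 1}"

definition null_hypothesis :: "nat \<Rightarrow> real mat \<Rightarrow> bool" where
  "null_hypothesis n \<Psi> \<longleftrightarrow>
     covariance_mat n \<Psi> \<and> (\<forall>i<n. \<Psi> $$ (i, i) = 1) \<and>
     (\<forall>i j. i < j \<and> j < n \<longrightarrow> \<Psi> $$ (i, j) = 0)"

text \<open>Since \<open>\<mu>\<close> and \<open>\<Sigma>\<close> are known, the level is only required at these values and a test may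
  depend on them.\<close>

definition level_tests ::
  "real \<Rightarrow> nat \<Rightarrow> nat \<Rightarrow> real vec \<Rightarrow> real mat \<Rightarrow> ((nat \<times> nat \<Rightarrow> real) \<Rightarrow> nat) set" where
  "level_tests \<alpha> n p \<mu> \<Sigma> =
     {T \<in> data_space n p \<rightarrow>\<^sub>M count_space {0, 1}.
        \<forall>\<Psi>. null_hypothesis n \<Psi> \<longrightarrow> rejection_prob n p \<mu> \<Sigma> \<Psi> T \<le> \<alpha>}"

definition d_entry :: "nat \<Rightarrow> real mat \<Rightarrow> nat \<Rightarrow> nat \<Rightarrow> real" where
  "d_entry n \<Psi> i j =
     \<Psi> $$ (i, j)
     - (\<Sum>k\<in>{..<n} - {i}. \<Psi> $$ (i, k)) / real n
     - (\<Sum>k\<in>{..<n} - {j}. \<Psi> $$ (j, k)) / real n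
     - (\<Sum>k<n. \<Sum>l\<in>{..<n} - {k}. \<Psi> $$ (k, l)) / (real n ^ 2 * (real n - 1))"

text \<open>Meaningful for \<open>n \<ge> 2\<close> only, as the maximum is otherwise over the empty set.\<close>

definition d_max :: "nat \<Rightarrow> real mat \<Rightarrow> real" where
  "d_max n \<Psi> = Max {\<bar>d_entry n \<Psi> i j\<bar> | i j. i < j \<and> j < n}"

definition alternatives :: "nat \<Rightarrow> nat \<Rightarrow> real \<Rightarrow> real mat set" where
  "alternatives n p \<delta> =
     {\<Psi>. positive_definite_mat n \<Psi> \<and> (\<forall>i<n. \<Psi> $$ (i, i) = 1) \<and>
         d_max n \<Psi> \<ge> \<delta> * sqrt (ln (real n) / real p)}"

end

theory Submission
  imports Defs "HOL-Real_Asymp.Real_Asymp"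
begin

text \<open>
The proof is Le Cam's method with a truncated likelihood ratio. Under the null hypothesis all
observations are independent; compare this with the alternatives in which exactly one pair of
observations \<open>i < j\<close> is correlated, with correlation \<open>\<rho>\<close>. The power of a test at the worst of these
\<open>N = n (n - 1) / 2\<close> alternatives is at most its average over the pairs, so it suffices that the
uniform mixture of the alternatives cannot be told apart from the null law. These alternatives lie in the
alternative set when \<open>\<rho> = \<delta> sqrt (ln n / p) / g n\<close>, with a factor \<open>g n\<close> that tends to 1, and
\<open>p > c n\<close> makes \<open>\<rho>\<close> small.

Let \<open>L i j\<close> be the likelihood ratio of the pair \<open>i, j\<close> against the null. Correlating two observations
leaves the law of each single one unchanged, so integrating out one of the two rows turns
\<open>L i j\<close> into 1, and therefore the ratios of different pairs are uncorrelated under the null, even when the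
pairs overlap. The variance of the averaged ratio is then about \<open>E (L i j)\<^sup>2 / N\<close>. But \<open>E (L i j)\<^sup>2\<close>
is about \<open>n\<close> to the power \<open>\<delta>\<^sup>2\<close>, which is below \<open>N\<close> only for \<open>\<delta>\<^sup>2 < 2\<close>. To reach \<open>\<delta>\<^sup>2 < 4\<close>,
discard the event \<open>L i j > K\<close> with \<open>K = n powr \<kappa>\<close> and \<open>\<kappa> < 2\<close>. The remaining second moment is at
most \<open>K\<close>, which is \<open>o(N)\<close>. The discarded mass is a probability under the alternative, and by
Markov's inequality it is at most \<open>E (L i j powr (1 + \<theta>)) / K powr \<theta>\<close>, where the expectation is
about \<open>n\<close> to the power \<open>\<theta> (1 + \<theta>) \<delta>\<^sup>2 / 2\<close>. This vanishes as soon as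
\<open>(1 + \<theta>) \<delta>\<^sup>2 / 2 < \<kappa>\<close>, and \<open>\<theta> > 0\<close> and \<open>\<kappa> < 2\<close> can be chosen so precisely because \<open>\<delta> < 2\<close>.
The probabilistic core is \<open>average_density_measure_le\<close>, the moment computation is
\<open>nn_integral_corr_kernel_powr\<close>, and both meet in \<open>exists_alternative_with_small_power\<close>.

The data need not have a density with respect to Lebesgue measure, since \<open>\<Sigma>\<close> may be singular.
All likelihood ratios are therefore taken on the level of independent standard normal rows, of
which the data are a linear image: \<open>\<Sigma>\<close> is factored as \<open>B B\<^sup>T\<close> (\<open>covariance_mat_factor\<close>). Since
\<open>gaussian_law\<close> is a definite description, identifying it with such an image
(\<open>gaussian_law_linear_image\<close>) requires the Cramer-Wold uniqueness theorem, which is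
\<open>PiM_borel_char_unique\<close>.
\<close>

section \<open>Laws on a finite product are determined by linear functionals\<close>

text \<open>Levy's uniqueness theorem speaks of probability measures. Evaluating the characteristic function at 0
shows that both measures have the same total mass, so both can be normalized.\<close>
lemma real_measure_char_unique:
  fixes M N :: "real measure"
  assumes fM: "finite_measure M" and fN: "finite_measure N"
    and sM: "sets M = sets borel" and sN: "sets N = sets borel"
    and eq: "\<And>t. (CLINT x|M. iexp (t * x)) = (CLINT x|N. iexp (t * x))"
  shows "M = N"
proof -
  interpret M: finite_measure M by fact
  interpret N: finite_measure N by fact
  note [measurable_cong] = sM sN
  define m where "m = measure M (space M)"
  have mN: "measure N (space N) = m"
    using eq[of 0] by (simp add: m_def)
  show ?thesis
  proof (cases "m = 0")
    case True
    show ?thesis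
    proof (rule measure_eqI)
      fix A assume "A \<in> sets M"
      have "emeasure M A \<le> emeasure M (space M)"
        by (rule emeasure_space)
      also have "\<dots> = 0" using True by (simp add: M.emeasure_eq_measure m_def)
      finally have 1: "emeasure M A = 0" by simp
      have "emeasure N A \<le> emeasure N (space N)"
        by (rule emeasure_space)
      also have "\<dots> = 0" using True mN by (simp add: N.emeasure_eq_measure)
      finally show "emeasure M A = emeasure N A" using 1 by simp
    qed (simp add: sM sN)
  next
    case False
    then have m: "m > 0" by (simp add: m_def zero_less_measure_iff)
    define S where "S L = density L (\<lambda>_. ennreal (1 / m))" for L :: "real measure"
    have S_real: "real_distribution (S L)"
      if "finite_measure L" "sets L = sets borel" "measure L (space L) = m" for L
    proof -
      interpret L: finite_measure L by fact
      have "emeasure (S L) (space L) = 1"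
        using m that(3) by (simp add: S_def emeasure_density_const L.emeasure_eq_measure
            flip: ennreal_mult)
      then have "prob_space (S L)" by (intro prob_spaceI) (simp add: S_def)
      then show ?thesis
        using that by (intro real_distribution.intro real_distribution_axioms.intro)
          (auto simp: S_def dest: sets_eq_imp_space_eq)
    qed
    have S_char: "char (S L) t = (1 / m) *\<^sub>R (CLINT x|L. iexp (t * x))"
      if "sets L = sets borel" for L t
    proof -
      note [measurable_cong] = that
      show ?thesis
        unfolding char_def S_def using m
        by (subst integral_density) auto
    qed
    have "S M = S N"
    proof (rule Levy_uniqueness)
      show "char (S M) = char (S N)"
        by (rule ext) (simp only: S_char sM sN eq)
    qed (auto intro!: S_real simp: fM fN sM sN mN m_def[symmetric])
    have inv: "density (S L) (\<lambda>_. ennreal m) = L" if "sets L = sets borel" for L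
    proof -
      note [measurable_cong] = that
      have "density (S L) (\<lambda>_. ennreal m) = density L (\<lambda>_. 1)"
        unfolding S_def using m
        by (subst density_density_eq) (auto intro!: density_cong simp flip: ennreal_mult)
      then show ?thesis by (simp add: density_1)
    qed
    show ?thesis using \<open>S M = S N\<close> inv[OF sM] inv[OF sN] by metis
  qed
qed

text \<open>Uniqueness for the push-forward under \<open>Y\<close> of the measure with density \<open>w\<close>.\<close>
lemma weighted_char_unique:
  fixes M N :: "'a measure" and w Y :: "'a \<Rightarrow> real"
  assumes fM: "finite_measure M" and fN: "finite_measure N" and sets: "sets M = sets N"
    and [measurable]: "w \<in> borel_measurable M" "Y \<in> borel_measurable M" "A \<in> sets borel"
    and w: "\<And>x. 0 \<le> w x" "\<And>x. w x \<le> b"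
    and eq: "\<And>t. (CLINT x|M. w x * iexp (t * Y x)) = (CLINT x|N. w x * iexp (t * Y x))"
  shows "(LINT x|M. w x * indicator A (Y x)) = (LINT x|N. w x * indicator A (Y x))"
proof -
  define D where "D L = distr (density L (\<lambda>x. ennreal (w x))) borel Y" for L
  have DL: "finite_measure (D L)" 
      "(CLINT y|D L. iexp (t * y)) = (CLINT x|L. w x * iexp (t * Y x))"
      "measure (D L) A = (LINT x|L. w x * indicator A (Y x))"
    if "finite_measure L" "sets L = sets M" for L t
  proof -
    note [measurable_cong] = that(2)
    interpret L: finite_measure L by fact
    have int: "integrable L w"
      using w by (intro L.integrable_const_bound[where B=b]) auto
    have fin: "emeasure (density L (\<lambda>x. ennreal (w x))) (space L) < \<infinity>"
      using int w by (simp add: emeasure_density nn_integral_eq_integral cong: nn_integral_cong_simp)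
    then interpret dL: finite_measure "density L (\<lambda>x. ennreal (w x))"
      by (intro finite_measureI) simp
    show "finite_measure (D L)"
      unfolding D_def by (intro dL.finite_measure_distr) measurable
    show "(CLINT y|D L. iexp (t * y)) = (CLINT x|L. w x * iexp (t * Y x))"
      unfolding D_def using w
      by (subst integral_distr, measurable, subst integral_density)
         (auto simp: scaleR_conv_of_real)
    have "measure (D L) A = (LINT y|D L. indicator A y)" by (simp add: D_def)
    also have "\<dots> = (LINT x|L. w x * indicator A (Y x))"
      unfolding D_def using w
      by (subst integral_distr, measurable, subst integral_density)
         auto
    finally show "measure (D L) A = (LINT x|L. w x * indicator A (Y x))" .
  qed
  have "D M = D N"
  proof (rule real_measure_char_unique)
    show "(CLINT y|D M. iexp (t * y)) = (CLINT y|D N. iexp (t * y))" for t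
      by (simp only: DL(2)[OF fM refl] DL(2)[OF fN sets[symmetric]] eq)
  qed (simp_all add: DL(1) fM fN sets, simp_all add: D_def)
  then show ?thesis
    using DL(3)[OF fM refl] DL(3)[OF fN sets[symmetric]] by simp
qed

text \<open>One coordinate \<open>Y\<close> is turned from a frequency into a set \<open>A\<close>, while the phase \<open>exp (\<i> H)\<close> of
the others is kept. A complex weight does not define a measure, so the phase is
recovered from the three nonnegative weights \<open>u\<close>, \<open>u (1 + cos H)\<close> and \<open>u (1 + sin H)\<close>, whose
characteristic functions only involve the phases \<open>s H + t Y\<close> with \<open>s \<in> {-1, 0, 1}\<close>.\<close>
lemma weighted_char_unique_phase:
  fixes M N :: "'a measure" and u H Y :: "'a \<Rightarrow> real"
  assumes fM: "finite_measure M" and fN: "finite_measure N" and sets: "sets M = sets N"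
    and [measurable]: "u \<in> borel_measurable M" "H \<in> borel_measurable M" "Y \<in> borel_measurable M"
      "A \<in> sets borel"
    and u: "\<And>x. 0 \<le> u x" "\<And>x. u x \<le> 1"
    and eq: "\<And>s t. (CLINT x|M. u x * iexp (s * H x + t * Y x)) = (CLINT x|N. u x * iexp (s * H x + t * Y x))"
  shows "(CLINT x|M. (u x * indicator A (Y x)) * iexp (H x)) =
         (CLINT x|N. (u x * indicator A (Y x)) * iexp (H x))"
proof -
  define j where "j s t x = complex_of_real (u x) * iexp (s * H x + t * Y x)" for s t x
  have int_bounded: "integrable L f"
    if "L = M \<or> L = N" "f \<in> borel_measurable L" "\<And>x. norm (f x) \<le> 1" for L and f :: "'a \<Rightarrow> 'b::{banach, second_countable_topology}"
    using that fM fN finite_measure.integrable_const_bound[of L f 1] by auto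
  note [measurable_cong] = sets[symmetric]
  have jm: "j s t \<in> borel_measurable L" if "L = M \<or> L = N" for s t L
    using that unfolding j_def by auto
  have jint: "integrable L (j s t)" if "L = M \<or> L = N" for s t L
    using that jm u by (intro int_bounded) (auto simp: j_def norm_mult simp del: of_real_mult of_real_add)
  have J: "integral\<^sup>L M (j s t) = integral\<^sup>L N (j s t)" for s t
    unfolding j_def[abs_def] by (rule eq)
  have cosI: "(u x * (1 + cos (H x))) * iexp (t * Y x) = j 0 t x + (j 1 t x + j (-1) t x) / 2" for x t
    by (simp add: j_def cos_exp_eq exp_add exp_minus field_simps exp_diff flip: cos_of_real)
  have sinI: "(u x * (1 + sin (H x))) * iexp (t * Y x) = j 0 t x + (j 1 t x - j (-1) t x) / (2 * \<i>)" for x t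
    by (simp add: j_def sin_exp_eq exp_add exp_minus field_simps exp_diff flip: sin_of_real)
  have bnd: "0 \<le> u x * (1 + c) \<and> u x * (1 + c) \<le> 2" if "\<bar>c\<bar> \<le> 1" for c x
    using u[of x] that mult_mono[of "u x" 1 "1 + c" 2] by auto
  have 0: "(LINT x|M. u x * indicator A (Y x)) = (LINT x|N. u x * indicator A (Y x))"
    using eq[of 0] by (intro weighted_char_unique[OF fM fN sets, where b = 1] u) simp_all
  have cos2: "(LINT x|M. (u x * (1 + cos (H x))) * indicator A (Y x)) =
             (LINT x|N. (u x * (1 + cos (H x))) * indicator A (Y x))"
  proof (rule weighted_char_unique[OF fM fN sets, where b = 2])
    show "0 \<le> u x * (1 + cos (H x))" "u x * (1 + cos (H x)) \<le> 2" for x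
      using bnd[of "cos (H x)" x] by auto
    show "(CLINT x|M. (u x * (1 + cos (H x))) * iexp (t * Y x)) =
          (CLINT x|N. (u x * (1 + cos (H x))) * iexp (t * Y x))" for t
      by (simp add: cosI jint J del: of_real_mult of_real_add)
  qed auto
  have sin2: "(LINT x|M. (u x * (1 + sin (H x))) * indicator A (Y x)) =
             (LINT x|N. (u x * (1 + sin (H x))) * indicator A (Y x))"
  proof (rule weighted_char_unique[OF fM fN sets, where b = 2])
    show "0 \<le> u x * (1 + sin (H x))" "u x * (1 + sin (H x)) \<le> 2" for x
      using bnd[of "sin (H x)" x] by auto
    show "(CLINT x|M. (u x * (1 + sin (H x))) * iexp (t * Y x)) =
          (CLINT x|N. (u x * (1 + sin (H x))) * iexp (t * Y x))" for t
      by (simp add: sinI jint J del: of_real_mult of_real_add)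
  qed auto
  have decomp: "(CLINT x|L. (u x * indicator A (Y x)) * iexp (H x)) =
     complex_of_real ((LINT x|L. (u x * (1 + cos (H x))) * indicator A (Y x)) - (LINT x|L. u x * indicator A (Y x)))
     + \<i> * complex_of_real ((LINT x|L. (u x * (1 + sin (H x))) * indicator A (Y x)) - (LINT x|L. u x * indicator A (Y x)))"
    if L: "L = M \<or> L = N" for L
  proof -
    have le1: "\<bar>u x * indicator A (Y x) * c\<bar> \<le> 1" if "\<bar>c\<bar> \<le> 1" for c x
      using u[of x] that mult_mono[of "u x" 1 "\<bar>c\<bar>" 1] by (auto simp: indicator_def abs_mult)
    have i0: "integrable L (\<lambda>x. u x * indicator A (Y x))"
      using L le1[of 1] by (intro int_bounded) auto
    have ic: "integrable L (\<lambda>x. u x * indicator A (Y x) * cos (H x))"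
      using L le1 by (intro int_bounded) auto
    have isn: "integrable L (\<lambda>x. u x * indicator A (Y x) * sin (H x))"
      using L le1 by (intro int_bounded) auto
    have c: "(LINT x|L. (u x * (1 + cos (H x))) * indicator A (Y x)) - (LINT x|L. u x * indicator A (Y x))
       = (LINT x|L. u x * indicator A (Y x) * cos (H x))"
      using i0 ic by (simp add: ring_distribs mult_ac)
    have s: "(LINT x|L. (u x * (1 + sin (H x))) * indicator A (Y x)) - (LINT x|L. u x * indicator A (Y x))
       = (LINT x|L. u x * indicator A (Y x) * sin (H x))"
      using i0 isn by (simp add: ring_distribs mult_ac)
    have e: "(u x * indicator A (Y x)) * iexp (H x) = complex_of_real (u x * indicator A (Y x) * cos (H x))
        + \<i> * complex_of_real (u x * indicator A (Y x) * sin (H x))" for x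
      by (simp add: exp_Euler cos_of_real sin_of_real ring_distribs mult_ac)
    show ?thesis unfolding c s e
      using ic isn by (subst Bochner_Integration.integral_add) 
        (auto simp del: of_real_mult simp: integral_mult_right_zero)
  qed
  show ?thesis by (simp only: decomp simp_thms 0 cos2 sin2)
qed

text \<open>The Cramer-Wold theorem. The coordinates are converted from frequencies to sets one at a time; when
all are converted, the two measures agree on boxes.\<close>
lemma PiM_borel_char_unique:
  fixes M N :: "('i \<Rightarrow> real) measure"
  assumes I: "finite I" and fM: "finite_measure M" and fN: "finite_measure N"
    and sM: "sets M = sets (\<Pi>\<^sub>M i\<in>I. borel)" and sN: "sets N = sets (\<Pi>\<^sub>M i\<in>I. borel)"
    and eq: "\<And>a. (CLINT x|M. iexp (\<Sum>i\<in>I. a i * x i)) = (CLINT x|N. iexp (\<Sum>i\<in>I. a i * x i))"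
  shows "M = N"
proof -
  interpret M: finite_measure M by fact
  interpret N: finite_measure N by fact
  note [measurable_cong] = sM sN
  show ?thesis
  proof (rule measure_eqI_PiM_finite[OF I sM sN])
    fix A :: "'i \<Rightarrow> real set"
    assume A: "\<And>i. i \<in> I \<Longrightarrow> A i \<in> sets borel"
    define w where "w F x = (\<Prod>i\<in>F. indicator (A i) (x i) :: real)" for F and x :: "'i \<Rightarrow> real"
    have w01: "0 \<le> w F x" "w F x \<le> 1" for F x
      unfolding w_def by (auto intro!: prod_nonneg prod_le_1)
    have box: "(CLINT x|M. w F x * iexp (\<Sum>i\<in>I. a i * x i)) =
               (CLINT x|N. w F x * iexp (\<Sum>i\<in>I. a i * x i))" if "F \<subseteq> I" for F a
      using finite_subset[OF that I] that
    proof (induction F arbitrary: a)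
      case empty
      show ?case using eq[of a] by (simp add: w_def)
    next
      case (insert j F)
      then have j: "j \<in> I" and F: "F \<subseteq> I" by auto
      have [measurable]: "w F \<in> borel_measurable (\<Pi>\<^sub>M i\<in>I. borel)"
      proof (unfold w_def, rule borel_measurable_prod)
        fix i assume "i \<in> F"
        then have [measurable]: "A i \<in> sets borel" "(\<lambda>x. x i) \<in> borel_measurable (\<Pi>\<^sub>M i\<in>I. borel :: real measure)"
          using F A by auto
        show "(\<lambda>x. indicator (A i) (x i) :: real) \<in> borel_measurable (\<Pi>\<^sub>M i\<in>I. borel)"
          by measurable
      qed
      have [measurable]: "(\<lambda>x. x j) \<in> borel_measurable (\<Pi>\<^sub>M i\<in>I. borel :: real measure)"
        by (rule measurable_component_singleton) fact
      have [measurable]: "A j \<in> sets borel" using A j by auto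
      have [measurable]: "(\<lambda>x. \<Sum>i\<in>I. a i * x i) \<in> borel_measurable (\<Pi>\<^sub>M i\<in>I. borel)"
        by (intro borel_measurable_sum borel_measurable_times measurable_component_singleton) auto
      have shift: "s * (\<Sum>i\<in>I. a i * x i) + t * x j =
          (\<Sum>i\<in>I. (s * a i + (if i = j then t else 0)) * x i)" for s t and x :: "'i \<Rightarrow> real"
        using I j by (simp add: ring_distribs sum.distrib sum_distrib_left mult.assoc
            if_distrib[of "\<lambda>u. u * _"] cong: if_cong)
      have "w (insert j F) x = w F x * indicator (A j) (x j)" for x
        using insert.hyps by (simp add: w_def)
      moreover have "(CLINT x|M. (w F x * indicator (A j) (x j)) * iexp (\<Sum>i\<in>I. a i * x i)) =
           (CLINT x|N. (w F x * indicator (A j) (x j)) * iexp (\<Sum>i\<in>I. a i * x i))"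
      proof (rule weighted_char_unique_phase[OF fM fN])
        show "(CLINT x|M. w F x * iexp (s * (\<Sum>i\<in>I. a i * x i) + t * x j)) =
          (CLINT x|N. w F x * iexp (s * (\<Sum>i\<in>I. a i * x i) + t * x j))" for s t
          unfolding shift by (rule insert.IH[OF F])
      qed (simp_all add: sM sN w01)
      ultimately show ?case by simp
    qed
    have wI: "w I x = indicator (Pi\<^sub>E I A) x" if "x \<in> (\<Pi>\<^sub>E i\<in>I. UNIV)" for x
      using that I by (auto simp: w_def indicator_def PiE_iff prod_zero_iff)
    have meas: "measure L (Pi\<^sub>E I A) = Re (CLINT x|L. w I x * iexp (\<Sum>i\<in>I. 0 * x i))"
      if "sets L = sets (\<Pi>\<^sub>M i\<in>I. borel)" for L :: "('i \<Rightarrow> real) measure"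
    proof -
      have sL: "space L = (\<Pi>\<^sub>E i\<in>I. UNIV)"
        using that by (auto dest!: sets_eq_imp_space_eq simp: space_PiM)
      have "(CLINT x|L. w I x * iexp (\<Sum>i\<in>I. 0 * x i)) = (CLINT x|L. complex_of_real (indicator (Pi\<^sub>E I A) x))"
        by (intro Bochner_Integration.integral_cong) (auto simp: wI sL)
      also have "\<dots> = complex_of_real (measure L (Pi\<^sub>E I A \<inter> space L))"
        by simp
      also have "Pi\<^sub>E I A \<inter> space L = Pi\<^sub>E I A" by (auto simp: sL PiE_iff)
      finally show ?thesis by simp
    qed
    show "emeasure M (Pi\<^sub>E I A) = emeasure N (Pi\<^sub>E I A)"
      using box[of I "\<lambda>_. 0"] meas[OF sM] meas[OF sN]
      by (simp add: M.emeasure_eq_measure N.emeasure_eq_measure)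
  next
    show "range (\<lambda>_::nat. space (\<Pi>\<^sub>M i\<in>I. borel)) \<subseteq> prod_algebra I (\<lambda>_. borel :: real measure)"
      using I by (auto simp: space_PiM intro!: prod_algebraI_finite)
  qed (auto simp: M.emeasure_eq_measure)
qed

section \<open>Gaussian laws as linear images of standard normals\<close>

lemma sets_normal_law[simp]: "sets (normal_law m v) = sets borel"
  by (simp add: normal_law_def)

lemma normal_law_affine:
  assumes "v \<ge> 0"
  shows "normal_law m v = distr std_normal_distribution borel (\<lambda>x. m + sqrt v * x)"
proof (cases "v = 0")
  case True
  interpret prob_space std_normal_distribution by (rule prob_space_normal_density) simp
  show ?thesis using True by (simp add: normal_law_def distr_const)
next
  case False
  interpret prob_space std_normal_distribution by (rule prob_space_normal_density) simp
  have "distributed std_normal_distribution lborel (\<lambda>x. x) std_normal_density"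
    by (simp add: distributed_def) (simp add: distr_id2 sets_eq_imp_space_eq)
  then have "distributed std_normal_distribution lborel (\<lambda>x. m + sqrt v * x)
      (normal_density (m + sqrt v * 0) (\<bar>sqrt v\<bar> * 1))"
    using False by (intro normal_density_affine) auto
  then have "distr std_normal_distribution lborel (\<lambda>x. m + sqrt v * x) =
      density lborel (normal_density m (sqrt v))"
    using assms by (simp add: distributed_def)
  moreover have "distr std_normal_distribution lborel (\<lambda>x. m + sqrt v * x) =
      distr std_normal_distribution borel (\<lambda>x. m + sqrt v * x)"
    by (rule distr_cong) auto
  ultimately show ?thesis using False by (simp add: normal_law_def)
qed

lemma prob_space_normal_law:
  assumes "v \<ge> 0"
  shows "prob_space (normal_law m v)"
proof -
  interpret prob_space std_normal_distribution by (rule prob_space_normal_density) simp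
  show ?thesis unfolding normal_law_affine[OF assms]
    by (intro prob_space_distr) simp
qed

lemma char_normal_law:
  assumes "v \<ge> 0"
  shows "char (normal_law m v) t = iexp (t * m) * complex_of_real (exp (- (v * t\<^sup>2) / 2))"
proof -
  have "char (normal_law m v) t = (CLINT x|std_normal_distribution. iexp (t * (m + sqrt v * x)))"
    unfolding char_def normal_law_affine[OF assms] by (subst integral_distr) auto
  also have "\<dots> = (CLINT x|std_normal_distribution. iexp (t * m) * iexp ((t * sqrt v) * x))"
    by (simp add: exp_add ring_distribs mult_ac)
  also have "\<dots> = iexp (t * m) * char std_normal_distribution (t * sqrt v)"
    unfolding char_def by (rule integral_mult_right_zero)
  also have "char std_normal_distribution (t * sqrt v) = complex_of_real (exp (- (v * t\<^sup>2) / 2))"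
    using assms by (simp add: char_std_normal_distribution power_mult_distrib mult.commute)
  finally show ?thesis .
qed

lemma normal_law_eqI:
  assumes "prob_space D" "sets D = sets borel" "v \<ge> 0"
    and "\<And>t. char D t = iexp (t * m) * complex_of_real (exp (- (v * t\<^sup>2) / 2))"
  shows "D = normal_law m v"
proof (rule Levy_uniqueness)
  show "real_distribution D" "real_distribution (normal_law m v)"
    using assms prob_space_normal_law[of v m]
    by (auto intro!: real_distribution.intro real_distribution_axioms.intro
          dest: sets_eq_imp_space_eq)
  show "char D = char (normal_law m v)"
    by (rule ext) (simp only: assms(4) char_normal_law[OF assms(3)])
qed

lemma distr_PiM_sum_normal_law:
  assumes I: "finite I" and prob: "\<And>i. prob_space (M i)"
    and f[measurable]: "\<And>i. f i \<in> borel_measurable (M i)"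
    and v: "\<And>i. i \<in> I \<Longrightarrow> v i \<ge> 0"
    and law: "\<And>i. i \<in> I \<Longrightarrow> distr (M i) borel (f i) = normal_law (m i) (v i)"
  shows "distr (\<Pi>\<^sub>M i\<in>I. M i) borel (\<lambda>x. \<Sum>i\<in>I. f i (x i)) = normal_law (\<Sum>i\<in>I. m i) (\<Sum>i\<in>I. v i)"
proof (rule normal_law_eqI)
  interpret product_prob_space M I
    by (rule product_prob_spaceI) (rule prob)
  have [measurable]: "(\<lambda>x. \<Sum>i\<in>I. f i (x i)) \<in> borel_measurable (\<Pi>\<^sub>M i\<in>I. M i)"
    by (rule borel_measurable_sum, rule measurable_compose[OF measurable_component_singleton]) auto
  show "prob_space (distr (\<Pi>\<^sub>M i\<in>I. M i) borel (\<lambda>x. \<Sum>i\<in>I. f i (x i)))"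
    by (intro prob_space_distr prob_space_PiM prob) auto
  show "(\<Sum>i\<in>I. v i) \<ge> 0" by (intro sum_nonneg v)
  fix t
  have "char (distr (\<Pi>\<^sub>M i\<in>I. M i) borel (\<lambda>x. \<Sum>i\<in>I. f i (x i))) t =
      (CLINT x|(\<Pi>\<^sub>M i\<in>I. M i). iexp (t * (\<Sum>i\<in>I. f i (x i))))"
    unfolding char_def by (subst integral_distr) auto
  also have "\<dots> = (CLINT x|(\<Pi>\<^sub>M i\<in>I. M i). (\<Prod>i\<in>I. iexp (t * f i (x i))))"
    using I by (simp add: sum_distrib_left exp_sum)
  also have "\<dots> = (\<Prod>i\<in>I. CLINT x|M i. iexp (t * f i x))"
  proof (intro product_integral_prod I)
    fix i
    show "integrable (M i) (\<lambda>x. iexp (t * f i x))"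
      by (rule finite_measure.integrable_const_bound[where B=1, OF prob_space.finite_measure[OF prob]])
        (auto simp del: of_real_mult)
  qed
  also have "\<dots> = (\<Prod>i\<in>I. iexp (t * m i) * complex_of_real (exp (- (v i * t\<^sup>2) / 2)))"
  proof (rule prod.cong[OF refl])
    fix i assume i: "i \<in> I"
    have "(CLINT x|M i. iexp (t * f i x)) = char (distr (M i) borel (f i)) t"
      unfolding char_def by (subst integral_distr) auto
    then show "(CLINT x|M i. iexp (t * f i x)) = iexp (t * m i) * complex_of_real (exp (- (v i * t\<^sup>2) / 2))"
      using i by (simp only: law char_normal_law v)
  qed
  also have "\<dots> = iexp (t * (\<Sum>i\<in>I. m i)) * complex_of_real (exp (- ((\<Sum>i\<in>I. v i) * t\<^sup>2) / 2))"
  proof -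
    have "(\<Prod>i\<in>I. exp (- (v i * t\<^sup>2) / 2)) = exp (\<Sum>i\<in>I. - (v i * t\<^sup>2) / 2)"
      by (rule exp_sum[OF I, symmetric])
    also have "(\<Sum>i\<in>I. - (v i * t\<^sup>2) / 2) = - ((\<Sum>i\<in>I. v i) * t\<^sup>2) / 2"
      by (simp add: sum_distrib_right sum_negf flip: sum_divide_distrib)
    finally have 1: "(\<Prod>i\<in>I. exp (- (v i * t\<^sup>2) / 2)) = exp (- ((\<Sum>i\<in>I. v i) * t\<^sup>2) / 2)" .
    have "(\<Prod>i\<in>I. iexp (t * m i)) = exp (\<Sum>i\<in>I. \<i> * complex_of_real (t * m i))"
      by (rule exp_sum[OF I, symmetric])
    also have "(\<Sum>i\<in>I. \<i> * complex_of_real (t * m i)) = \<i> * complex_of_real (t * (\<Sum>i\<in>I. m i))"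
      by (simp add: sum_distrib_left)
    finally have 2: "(\<Prod>i\<in>I. iexp (t * m i)) = iexp (t * (\<Sum>i\<in>I. m i))" .
    show ?thesis unfolding prod.distrib 2 1[symmetric] of_real_prod ..
  qed
  finally show "char (distr (\<Pi>\<^sub>M i\<in>I. M i) borel (\<lambda>x. \<Sum>i\<in>I. f i (x i))) t =
    iexp (t * (\<Sum>i\<in>I. m i)) * complex_of_real (exp (- ((\<Sum>i\<in>I. v i) * t\<^sup>2) / 2))" .
qed simp

text \<open>The prescribed laws of the linear functionals fix the characteristic function, so at most one
measure satisfies the description.\<close>
lemma gaussian_law_eqI:
  assumes I: "finite I" and M: "is_gaussian_law I m K M"
  shows "gaussian_law I m K = M"
  unfolding gaussian_law_def
proof (rule the_equality)
  fix N assume N: "is_gaussian_law I m K N"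
  have ch: "(CLINT x|L. iexp (\<Sum>i\<in>I. a i * x i)) =
      char (normal_law (\<Sum>i\<in>I. a i * m i) (\<Sum>i\<in>I. \<Sum>j\<in>I. a i * a j * K i j)) 1"
    if L: "is_gaussian_law I m K L" for L a
  proof -
    from L have [measurable_cong]: "sets L = sets (\<Pi>\<^sub>M i\<in>I. borel)"
      by (simp add: is_gaussian_law_def)
    have [measurable]: "(\<lambda>x. \<Sum>i\<in>I. a i * x i) \<in> borel_measurable (\<Pi>\<^sub>M i\<in>I. borel)"
      by (intro borel_measurable_sum borel_measurable_times measurable_component_singleton) auto
    have "char (distr L borel (\<lambda>x. \<Sum>i\<in>I. a i * x i)) 1 = (CLINT x|L. iexp (\<Sum>i\<in>I. a i * x i))"
      unfolding char_def by (subst integral_distr) auto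
    then show ?thesis using L by (simp add: is_gaussian_law_def)
  qed
  show "N = M"
    using M N by (intro PiM_borel_char_unique[OF I])
      (auto simp: is_gaussian_law_def ch intro: prob_space.finite_measure simp del: of_real_sum)
qed (rule M)

text \<open>The source \<open>\<xi>\<close> is described through its linear functionals, so that it can be any realization of
independent standard normals, in particular a product of products.\<close>
lemma gaussian_law_linear_image:
  assumes I: "finite I" and R: "finite R" and M: "prob_space M"
    and xi[measurable]: "\<And>r. r \<in> R \<Longrightarrow> \<xi> r \<in> borel_measurable M"
    and std: "\<And>c. distr M borel (\<lambda>\<omega>. \<Sum>r\<in>R. c r * \<xi> r \<omega>) = normal_law 0 (\<Sum>r\<in>R. (c r)\<^sup>2)"
    and K: "\<And>i j. i \<in> I \<Longrightarrow> j \<in> I \<Longrightarrow> K i j = (\<Sum>r\<in>R. B i r * B j r)"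
  shows "gaussian_law I m K = distr M (\<Pi>\<^sub>M i\<in>I. borel) (\<lambda>\<omega>. \<lambda>i\<in>I. m i + (\<Sum>r\<in>R. B i r * \<xi> r \<omega>))"
proof (rule gaussian_law_eqI[OF I])
  interpret prob_space M by fact
  let ?F = "\<lambda>\<omega>. \<lambda>i\<in>I. m i + (\<Sum>r\<in>R. B i r * \<xi> r \<omega>)"
  have F[measurable]: "?F \<in> M \<rightarrow>\<^sub>M (\<Pi>\<^sub>M i\<in>I. borel)"
    by (intro measurable_restrict) auto
  show "is_gaussian_law I m K (distr M (\<Pi>\<^sub>M i\<in>I. borel) ?F)"
    unfolding is_gaussian_law_def
  proof (intro conjI allI)
    fix a :: "'a \<Rightarrow> real"
    have [measurable]: "(\<lambda>x. \<Sum>i\<in>I. a i * x i) \<in> borel_measurable (\<Pi>\<^sub>M i\<in>I. borel)"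
      by (intro borel_measurable_sum borel_measurable_times measurable_component_singleton) auto
    define c where "c r = (\<Sum>i\<in>I. a i * B i r)" for r
    let ?m = "\<Sum>i\<in>I. a i * m i" and ?v = "\<Sum>r\<in>R. (c r)\<^sup>2"
    have v: "0 \<le> ?v" by (intro sum_nonneg) simp
    have eq: "(\<Sum>i\<in>I. a i * (m i + (\<Sum>r\<in>R. B i r * \<xi> r \<omega>))) = ?m + (\<Sum>r\<in>R. c r * \<xi> r \<omega>)" for \<omega>
    proof -
      have "(\<Sum>i\<in>I. a i * (m i + (\<Sum>r\<in>R. B i r * \<xi> r \<omega>))) = ?m + (\<Sum>i\<in>I. \<Sum>r\<in>R. a i * B i r * \<xi> r \<omega>)"
        by (simp add: ring_distribs sum.distrib sum_distrib_left mult.assoc)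
      also have "(\<Sum>i\<in>I. \<Sum>r\<in>R. a i * B i r * \<xi> r \<omega>) = (\<Sum>r\<in>R. c r * \<xi> r \<omega>)"
        unfolding c_def sum_distrib_right by (rule sum.swap)
      finally show ?thesis by simp
    qed
    have "distr (distr M (\<Pi>\<^sub>M i\<in>I. borel) ?F) borel (\<lambda>x. \<Sum>i\<in>I. a i * x i) =
        distr M borel (\<lambda>\<omega>. ?m + (\<Sum>r\<in>R. c r * \<xi> r \<omega>))"
      by (subst distr_distr) (auto simp: comp_def eq)
    also have "\<dots> = normal_law ?m ?v"
    proof (rule normal_law_eqI[OF _ _ v])
      fix t
      have "char (distr M borel (\<lambda>\<omega>. ?m + (\<Sum>r\<in>R. c r * \<xi> r \<omega>))) t =
         (CLINT \<omega>|M. iexp (t * ?m) * iexp (t * (\<Sum>r\<in>R. c r * \<xi> r \<omega>)))"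
        unfolding char_def by (subst integral_distr) (auto simp: exp_add ring_distribs simp del: of_real_sum)
      also have "\<dots> = iexp (t * ?m) * char (distr M borel (\<lambda>\<omega>. \<Sum>r\<in>R. c r * \<xi> r \<omega>)) t"
        unfolding char_def by (subst integral_distr) (auto simp del: of_real_sum of_real_mult)
      also have "\<dots> = iexp (t * ?m) * complex_of_real (exp (- (?v * t\<^sup>2) / 2))"
        unfolding std by (subst char_normal_law[OF v]) simp
      finally show "char (distr M borel (\<lambda>\<omega>. ?m + (\<Sum>r\<in>R. c r * \<xi> r \<omega>))) t =
         iexp (t * ?m) * complex_of_real (exp (- (?v * t\<^sup>2) / 2))" .
    qed (auto intro!: prob_space_distr)
    also have "?v = (\<Sum>i\<in>I. \<Sum>j\<in>I. a i * a j * K i j)"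
    proof -
      have "?v = (\<Sum>r\<in>R. \<Sum>i\<in>I. \<Sum>j\<in>I. a i * a j * (B i r * B j r))"
        by (simp add: c_def power2_eq_square sum_product mult_ac)
      also have "\<dots> = (\<Sum>i\<in>I. \<Sum>r\<in>R. \<Sum>j\<in>I. a i * a j * (B i r * B j r))"
        by (rule sum.swap)
      also have "\<dots> = (\<Sum>i\<in>I. \<Sum>j\<in>I. \<Sum>r\<in>R. a i * a j * (B i r * B j r))"
        by (intro sum.cong refl sum.swap)
      also have "\<dots> = (\<Sum>i\<in>I. \<Sum>j\<in>I. a i * a j * K i j)"
        by (simp add: K sum_distrib_left)
      finally show ?thesis .
    qed
    finally show "distr (distr M (\<Pi>\<^sub>M i\<in>I. borel) ?F) borel (\<lambda>x. \<Sum>i\<in>I. a i * x i) =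
       normal_law ?m (\<Sum>i\<in>I. \<Sum>j\<in>I. a i * a j * K i j)" .
  qed (auto intro!: prob_space_distr)
qed

section \<open>Gram factorization of a covariance matrix\<close>

text \<open>Symmetric Gaussian elimination: splitting off the row of \<open>k\<close> leaves the Schur complement, which is
again positive semidefinite. If the pivot \<open>K k k\<close> is 0 then the whole row of \<open>k\<close> is 0, and division
by \<open>sqrt 0\<close> yields the right vector \<open>b = 0\<close>.\<close>
lemma psd_kernel_gram_factor:
  fixes K :: "'i \<Rightarrow> 'i \<Rightarrow> real"
  assumes "finite I"
    and "\<And>i j. i \<in> I \<Longrightarrow> j \<in> I \<Longrightarrow> K i j = K j i"
    and "\<And>c. 0 \<le> (\<Sum>i\<in>I. \<Sum>j\<in>I. c i * c j * K i j)"
  shows "\<exists>B. \<forall>i\<in>I. \<forall>j\<in>I. K i j = (\<Sum>r\<in>I. B i r * B j r)"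
  using assms
proof (induction I arbitrary: K rule: finite_induct)
  case empty
  then show ?case by simp
next
  case (insert k I)
  note sym = insert.prems(1) and psd = insert.prems(2)
  have quad: "(\<Sum>i\<in>insert k I. \<Sum>j\<in>insert k I. c i * c j * K i j) =
      (c k)\<^sup>2 * K k k + 2 * c k * (\<Sum>j\<in>I. c j * K k j) + (\<Sum>i\<in>I. \<Sum>j\<in>I. c i * c j * K i j)" for c
  proof -
    have "(\<Sum>i\<in>I. c i * c k * K i k) = c k * (\<Sum>j\<in>I. c j * K k j)"
      unfolding sum_distrib_left using sym by (intro sum.cong) (auto simp: mult_ac)
    moreover have "(\<Sum>j\<in>I. c k * c j * K k j) = c k * (\<Sum>j\<in>I. c j * K k j)"
      unfolding sum_distrib_left by (intro sum.cong) (auto simp: mult_ac)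
    ultimately show ?thesis
      using insert.hyps by (simp add: sum.distrib power2_eq_square algebra_simps)
  qed
  have psdI: "0 \<le> (x::real)\<^sup>2 * K k k + 2 * x * (\<Sum>j\<in>I. c j * K k j) + (\<Sum>i\<in>I. \<Sum>j\<in>I. c i * c j * K i j)" for x c
  proof -
    let ?d = "c(k := x)"
    have "(\<Sum>j\<in>I. ?d j * K k j) = (\<Sum>j\<in>I. c j * K k j)"
      using insert.hyps by (intro sum.cong) auto
    moreover have "(\<Sum>i\<in>I. \<Sum>j\<in>I. ?d i * ?d j * K i j) = (\<Sum>i\<in>I. \<Sum>j\<in>I. c i * c j * K i j)"
      using insert.hyps by (intro sum.cong refl) auto
    ultimately show ?thesis
      using psd[of ?d] unfolding quad by simp
  qed
  have Kkk: "0 \<le> K k k" using psdI[of 1 "\<lambda>_. 0"] by simp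
  define b where "b i = K k i / sqrt (K k k)" for i
  define K' where "K' i j = K i j - b i * b j" for i j
  have row: "K k i = 0" if "K k k = 0" "i \<in> I" for i
  proof (rule ccontr)
    assume ne: "K k i \<noteq> 0"
    have s: "(\<Sum>j\<in>I. (if j = i then 1 else 0) * K k j) = K k i"
      using that insert.hyps by (simp add: if_distrib[of "\<lambda>u. u * _"] cong: if_cong)
    define Q where "Q = (\<Sum>i'\<in>I. \<Sum>j\<in>I. (if i' = i then 1 else 0) * (if j = i then 1 else 0) * K i' j)"
    have "0 \<le> 2 * x * K k i + Q" for x
      using psdI[of x "\<lambda>j. if j = i then 1 else 0"] that(1) unfolding s Q_def by simp
    \<comment> \<open>An affine function of \<open>x\<close> with nonzero slope takes the value -1.\<close>
    from this[of "- (Q + 1) / (2 * K k i)"] show False using ne by (simp add: field_simps)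
  qed
  have bk: "b k * b i = K k i" if "i \<in> insert k I" for i
    using that row Kkk by (cases "K k k = 0") (auto simp: b_def field_simps)
  have bb: "b i * b j * K k k = K k i * K k j" if "i \<in> I" "j \<in> I" for i j
    using that row Kkk by (cases "K k k = 0") (auto simp: b_def field_simps)
  have "\<exists>B. \<forall>i\<in>I. \<forall>j\<in>I. K' i j = (\<Sum>r\<in>I. B i r * B j r)"
  proof (rule insert.IH)
    show "K' i j = K' j i" if "i \<in> I" "j \<in> I" for i j
      using sym that by (simp add: K'_def)
    fix c :: "'i \<Rightarrow> real"
    let ?l = "\<Sum>j\<in>I. c j * K k j" and ?b = "\<Sum>j\<in>I. c j * b j"
    have "(\<Sum>i\<in>I. \<Sum>j\<in>I. c i * c j * K' i j) = (\<Sum>i\<in>I. \<Sum>j\<in>I. c i * c j * K i j) - ?b\<^sup>2"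
      by (simp add: K'_def power2_eq_square sum_product sum_subtractf right_diff_distrib mult_ac)
    moreover have "0 \<le> (\<Sum>i\<in>I. \<Sum>j\<in>I. c i * c j * K i j) - ?b\<^sup>2"
    proof (cases "K k k = 0")
      case True
      then have "?b = 0" by (simp add: b_def)
      then show ?thesis using psdI[of 0 c] by simp
    next
      case False
      have "?b = ?l / sqrt (K k k)" by (simp add: b_def sum_divide_distrib)
      then have "?b\<^sup>2 = ?l\<^sup>2 / K k k" using Kkk by (simp add: power_divide)
      \<comment> \<open>The quadratic form is minimal in the direction of \<open>k\<close> at \<open>x = - l / K k k\<close>.\<close>
      moreover have "(- l / K k k)\<^sup>2 * K k k + 2 * (- l / K k k) * l = - (l\<^sup>2 / K k k)" for l
        using False by (simp add: power2_eq_square field_simps)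
      ultimately show ?thesis
        using psdI[of "- ?l / K k k" c] by simp
    qed
    ultimately show "0 \<le> (\<Sum>i\<in>I. \<Sum>j\<in>I. c i * c j * K' i j)" by simp
  qed
  then obtain B where B: "\<And>i j. i \<in> I \<Longrightarrow> j \<in> I \<Longrightarrow> K' i j = (\<Sum>r\<in>I. B i r * B j r)" by blast
  define C where "C i r = (if r = k then b i else if i = k then 0 else B i r)" for i r
  have "K i j = (\<Sum>r\<in>insert k I. C i r * C j r)" if ij: "i \<in> insert k I" "j \<in> insert k I" for i j
  proof -
    have "(\<Sum>r\<in>insert k I. C i r * C j r) = b i * b j + (\<Sum>r\<in>I. C i r * C j r)"
      using insert.hyps by (simp add: C_def)
    moreover have "(\<Sum>r\<in>I. C i r * C j r) = (if i = k \<or> j = k then 0 else K' i j)"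
    proof (cases "i = k \<or> j = k")
      case True
      have "C i r * C j r = 0" if "r \<in> I" for r
        using that True insert.hyps by (auto simp: C_def)
      then have "(\<Sum>r\<in>I. C i r * C j r) = 0" by (rule sum.neutral[OF ballI])
      then show ?thesis using True by simp
    next
      case False
      then have "K' i j = (\<Sum>r\<in>I. B i r * B j r)" using ij by (intro B) auto
      also have "\<dots> = (\<Sum>r\<in>I. C i r * C j r)"
        using False insert.hyps by (intro sum.cong) (auto simp: C_def)
      finally show ?thesis using False by simp
    qed
    ultimately show ?thesis
      using bk[OF ij(1)] bk[OF ij(2)] sym[OF ij] by (auto simp: K'_def mult.commute)
  qed
  then show ?case by blast
qed

lemma covariance_mat_factor:
  assumes "covariance_mat p \<Sigma>"
  shows "\<exists>B. \<forall>k<p. \<forall>l<p. \<Sigma> $$ (k, l) = (\<Sum>r<p. B k r * B l r)"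
proof -
  from assms have C: "\<Sigma> \<in> carrier_mat p p" and T: "transpose_mat \<Sigma> = \<Sigma>"
    and P: "\<And>v. v \<in> carrier_vec p \<Longrightarrow> v \<bullet> (\<Sigma> *\<^sub>v v) \<ge> 0"
    by (auto simp: covariance_mat_def)
  have "\<exists>B. \<forall>k\<in>{..<p}. \<forall>l\<in>{..<p}. \<Sigma> $$ (k, l) = (\<Sum>r\<in>{..<p}. B k r * B l r)"
  proof (rule psd_kernel_gram_factor)
    show "\<Sigma> $$ (i, j) = \<Sigma> $$ (j, i)" if "i \<in> {..<p}" "j \<in> {..<p}" for i j
      using that C T by (metis carrier_matD index_transpose_mat(1) lessThan_iff)
    fix c :: "nat \<Rightarrow> real"
    have "vec p c \<bullet> (\<Sigma> *\<^sub>v vec p c) = (\<Sum>i<p. \<Sum>j<p. c i * c j * \<Sigma> $$ (i, j))"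
      using C by (simp add: scalar_prod_def sum_distrib_left mult_ac atLeast0LessThan)
    then show "0 \<le> (\<Sum>i<p. \<Sum>j<p. c i * c j * \<Sigma> $$ (i, j))"
      using P[of "vec p c"] by simp
  qed simp
  then show ?thesis by (simp only: Ball_def lessThan_iff)
qed

section \<open>The likelihood ratio of a correlated pair of standard normals\<close>

abbreviation "std_normal \<equiv> normal_law 0 1"

lemma std_normal_density_eq: "std_normal = density lborel (\<lambda>x. ennreal (std_normal_density x))"
  by (simp add: normal_law_def)

lemma sets_std_normal[measurable_cong, simp]: "sets std_normal = sets borel"
  by (simp add: normal_law_def)

lemma measurable_std_normal[simp]: "std_normal \<rightarrow>\<^sub>M N = borel \<rightarrow>\<^sub>M N"
  by (rule measurable_cong_sets) simp_all

lemma space_std_normal[simp]: "space std_normal = UNIV"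
  by (simp add: normal_law_def)

lemma prob_space_std_normal: "prob_space std_normal"
  unfolding std_normal_density_eq by (rule prob_space_normal_density) simp

text \<open>This is the density of the bivariate normal law with unit variances and correlation \<open>\<rho>\<close>,
relative to the product of its marginals (the Mehler kernel).\<close>
definition corr_kernel :: "real \<Rightarrow> real \<Rightarrow> real \<Rightarrow> real" where
  "corr_kernel \<rho> z w =
     exp (- (\<rho>\<^sup>2 * z\<^sup>2 - 2 * \<rho> * z * w + \<rho>\<^sup>2 * w\<^sup>2) / (2 * (1 - \<rho>\<^sup>2))) / sqrt (1 - \<rho>\<^sup>2)"

lemma corr_kernel_commute: "corr_kernel \<rho> z w = corr_kernel \<rho> w z"
  by (simp add: corr_kernel_def algebra_simps)

lemma corr_kernel_pos: "\<bar>\<rho>\<bar> < 1 \<Longrightarrow> 0 < corr_kernel \<rho> z w"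
  by (simp add: corr_kernel_def abs_square_less_1)

lemma measurable_corr_kernel[measurable]:
  "(\<lambda>x. corr_kernel \<rho> (f x) (g x)) \<in> borel_measurable M"
  if "f \<in> borel_measurable M" "g \<in> borel_measurable M"
  using that unfolding corr_kernel_def by measurable

lemma std_normal_density_times_corr_kernel:
  assumes "\<bar>\<rho>\<bar> < 1"
  shows "std_normal_density w * corr_kernel \<rho> z w = normal_density (\<rho> * z) (sqrt (1 - \<rho>\<^sup>2)) w"
proof -
  have r: "1 - \<rho>\<^sup>2 > 0" using assms by (simp add: abs_square_less_1)
  have "- w\<^sup>2 / 2 + - (\<rho>\<^sup>2 * z\<^sup>2 - 2 * \<rho> * z * w + \<rho>\<^sup>2 * w\<^sup>2) / (2 * (1 - \<rho>\<^sup>2)) =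
        - (w - \<rho> * z)\<^sup>2 / (2 * (1 - \<rho>\<^sup>2))"
    using r by (simp add: divide_simps) (simp add: power2_eq_square algebra_simps)
  then show ?thesis using r
    by (simp add: std_normal_density_def normal_density_def corr_kernel_def real_sqrt_mult
        mult_exp_exp)
qed

text \<open>Given the first variable \<open>z\<close>, the second one is distributed as \<open>\<rho> z\<close> plus independent noise of
variance \<open>1 - \<rho>\<^sup>2\<close>.\<close>
lemma distr_std_normal_corr_kernel:
  assumes "\<bar>\<rho>\<bar> < 1"
  shows "density std_normal (\<lambda>w. ennreal (corr_kernel \<rho> z w)) =
    distr std_normal borel (\<lambda>w. \<rho> * z + sqrt (1 - \<rho>\<^sup>2) * w)"
proof -
  have r: "1 - \<rho>\<^sup>2 > 0" using assms by (simp add: abs_square_less_1)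
  have "density std_normal (\<lambda>w. ennreal (corr_kernel \<rho> z w)) =
      density lborel (\<lambda>w. ennreal (normal_density (\<rho> * z) (sqrt (1 - \<rho>\<^sup>2)) w))"
    unfolding std_normal_density_eq
    using assms corr_kernel_pos[OF assms]
    by (subst density_density_eq)
       (auto simp: std_normal_density_times_corr_kernel[symmetric] ennreal_mult less_imp_le)
  also have "\<dots> = normal_law (\<rho> * z) (1 - \<rho>\<^sup>2)"
    using r by (simp add: normal_law_def)
  finally show ?thesis 
    using r normal_law_affine[of "1 - \<rho>\<^sup>2" "\<rho> * z"] by (simp add: std_normal_density_eq)
qed

lemma nn_integral_corr_kernel:
  assumes "\<bar>\<rho>\<bar> < 1"
  shows "(\<integral>\<^sup>+w. ennreal (corr_kernel \<rho> z w) \<partial>std_normal) = 1"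
proof -
  interpret prob_space std_normal by (rule prob_space_std_normal)
  interpret D: prob_space "distr std_normal borel (\<lambda>w. \<rho> * z + sqrt (1 - \<rho>\<^sup>2) * w)"
    by (intro prob_space_distr) simp
  have "(\<integral>\<^sup>+w. ennreal (corr_kernel \<rho> z w) \<partial>std_normal) =
      emeasure (density std_normal (\<lambda>w. ennreal (corr_kernel \<rho> z w))) UNIV"
    by (subst emeasure_density) auto
  then show ?thesis
    using D.emeasure_space_1 by (simp add: distr_std_normal_corr_kernel[OF assms])
qed

text \<open>Completing the square: the integrand times the standard normal density is a multiple of the
normal density with mean \<open>b / D\<close> and variance \<open>1 / D\<close>.\<close>
lemma nn_integral_std_normal_exp_quadratic:
  assumes D: "D > 0"
  shows "(\<integral>\<^sup>+w. ennreal (exp ((1 - D) / 2 * w\<^sup>2 + b * w)) \<partial>std_normal) =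
    ennreal (exp (b\<^sup>2 / (2 * D)) / sqrt D)"
proof -
  let ?c = "exp (b\<^sup>2 / (2 * D)) / sqrt D"
  have eq: "std_normal_density w * exp ((1 - D) / 2 * w\<^sup>2 + b * w) =
      ?c * normal_density (b / D) (1 / sqrt D) w" for w
  proof -
    have "- w\<^sup>2 / 2 + ((1 - D) / 2 * w\<^sup>2 + b * w) = b\<^sup>2 / (2 * D) + - (w - b / D)\<^sup>2 / (2 * (1 / sqrt D)\<^sup>2)"
      using D by (simp add: power_divide divide_simps) (simp add: power2_eq_square algebra_simps)
    then have "exp (- w\<^sup>2 / 2) * exp ((1 - D) / 2 * w\<^sup>2 + b * w) =
        exp (b\<^sup>2 / (2 * D)) * exp (- (w - b / D)\<^sup>2 / (2 * (1 / sqrt D)\<^sup>2))"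
      by (simp only: mult_exp_exp)
    then show ?thesis using D
      by (simp add: std_normal_density_def normal_density_def real_sqrt_divide power_divide)
  qed
  have eq': "ennreal (std_normal_density w) * ennreal (exp ((1 - D) / 2 * w\<^sup>2 + b * w)) =
      ennreal ?c * ennreal (normal_density (b / D) (1 / sqrt D) w)" for w
  proof -
    have "ennreal (std_normal_density w) * ennreal (exp ((1 - D) / 2 * w\<^sup>2 + b * w)) =
        ennreal (?c * normal_density (b / D) (1 / sqrt D) w)"
      unfolding eq[symmetric] by (rule ennreal_mult[symmetric]) auto
    also have "\<dots> = ennreal ?c * ennreal (normal_density (b / D) (1 / sqrt D) w)"
      using D by (intro ennreal_mult) auto
    finally show ?thesis .
  qed
  have "(\<integral>\<^sup>+w. ennreal (exp ((1 - D) / 2 * w\<^sup>2 + b * w)) \<partial>std_normal) =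
      (\<integral>\<^sup>+w. ennreal ?c * ennreal (normal_density (b / D) (1 / sqrt D) w) \<partial>lborel)"
    unfolding std_normal_density_eq using D
    by (subst nn_integral_density, measurable) (simp only: eq')
  also have "\<dots> = ennreal ?c * (\<integral>\<^sup>+w. ennreal (normal_density (b / D) (1 / sqrt D) w) \<partial>lborel)"
    by (rule nn_integral_cmult) simp
  also have "(\<integral>\<^sup>+w. ennreal (normal_density (b / D) (1 / sqrt D) w) \<partial>lborel) = 1"
    using D by (subst nn_integral_eq_integral) auto
  finally show ?thesis by simp
qed

text \<open>The power of the kernel is again the exponential of a quadratic form, so both integrals are
Gaussian. The combined precision matrix has diagonal entries \<open>D\<close> and off-diagonal entries \<open>- \<kappa>\<close>;
its determinant \<open>D\<^sup>2 - \<kappa>\<^sup>2\<close> collapses to \<open>(1 - \<theta>\<^sup>2 \<rho>\<^sup>2) / (1 - \<rho>\<^sup>2)\<close>, which is what makes the closed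
form short. For \<open>\<theta> = 0\<close> the value is 1, and to leading order it is \<open>exp (\<theta> (1 + \<theta>) \<rho>\<^sup>2 / 2)\<close>.\<close>
lemma nn_integral_corr_kernel_powr:
  assumes r: "\<bar>\<rho>\<bar> < 1" and th: "0 \<le> \<theta>" "\<theta> \<le> 1"
  shows "(\<integral>\<^sup>+z. \<integral>\<^sup>+w. ennreal (corr_kernel \<rho> z w powr (1 + \<theta>)) \<partial>std_normal \<partial>std_normal) =
    ennreal ((1 - \<rho>\<^sup>2) powr (- \<theta> / 2) * (1 - \<theta>\<^sup>2 * \<rho>\<^sup>2) powr (- 1 / 2))"
proof -
  define R where "R = 1 - \<rho>\<^sup>2"
  have R: "R > 0" using r by (simp add: R_def abs_square_less_1)
  have T: "1 - \<theta>\<^sup>2 * \<rho>\<^sup>2 > 0"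
  proof -
    have "\<theta>\<^sup>2 * \<rho>\<^sup>2 \<le> 1 * \<rho>\<^sup>2" using th by (intro mult_right_mono) (auto simp: power_le_one)
    then show ?thesis using R by (simp add: R_def)
  qed
  define \<kappa> where "\<kappa> = (1 + \<theta>) * \<rho> / R"
  define D where "D = 1 + \<kappa> * \<rho>"
  define C where "C = R powr (- (1 + \<theta>) / 2)"
  have "\<kappa> * \<rho> = (1 + \<theta>) * \<rho>\<^sup>2 / R" by (simp add: \<kappa>_def power2_eq_square)
  then have D: "D > 0" using R th by (simp add: D_def add_pos_nonneg)
  have det: "D\<^sup>2 - \<kappa>\<^sup>2 = (1 - \<theta>\<^sup>2 * \<rho>\<^sup>2) / R"
  proof -
    have "D * R = 1 + \<theta> * \<rho>\<^sup>2" using R by (simp add: D_def \<kappa>_def R_def power2_eq_square field_simps)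
    moreover have "\<kappa> * R = (1 + \<theta>) * \<rho>" using R by (simp add: \<kappa>_def)
    ultimately have "(D\<^sup>2 - \<kappa>\<^sup>2) * R\<^sup>2 = (1 + \<theta> * \<rho>\<^sup>2)\<^sup>2 - ((1 + \<theta>) * \<rho>)\<^sup>2"
      by (metis left_diff_distrib power_mult_distrib)
    also have "\<dots> = (1 - \<theta>\<^sup>2 * \<rho>\<^sup>2) * R"
      by (simp add: R_def power2_eq_square algebra_simps)
    finally have "((D\<^sup>2 - \<kappa>\<^sup>2) * R) * R = (1 - \<theta>\<^sup>2 * \<rho>\<^sup>2) * R"
      unfolding power2_eq_square[of R] mult.assoc .
    then have "(D\<^sup>2 - \<kappa>\<^sup>2) * R = 1 - \<theta>\<^sup>2 * \<rho>\<^sup>2" using R by simp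
    then show ?thesis using R by (simp add: eq_divide_eq)
  qed
  have det_pos: "(D\<^sup>2 - \<kappa>\<^sup>2) / D > 0" unfolding det using R T D by simp
  have pw: "corr_kernel \<rho> z w powr (1 + \<theta>) =
      C * exp ((1 - D) / 2 * z\<^sup>2) * exp ((1 - D) / 2 * w\<^sup>2 + (\<kappa> * z) * w)" for z w
  proof -
    have e: "(- (\<rho>\<^sup>2 * z\<^sup>2 - 2 * \<rho> * z * w + \<rho>\<^sup>2 * w\<^sup>2) / (2 * R)) * (1 + \<theta>) =
       (1 - D) / 2 * z\<^sup>2 + ((1 - D) / 2 * w\<^sup>2 + (\<kappa> * z) * w)"
      using R by (simp add: D_def \<kappa>_def power2_eq_square divide_simps) (simp add: algebra_simps)
    have "1 / sqrt R = R powr (- (1 / 2))" using R by (simp add: powr_minus_divide powr_half_sqrt)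
    then have "corr_kernel \<rho> z w = exp (- (\<rho>\<^sup>2 * z\<^sup>2 - 2 * \<rho> * z * w + \<rho>\<^sup>2 * w\<^sup>2) / (2 * R)) * R powr (- (1 / 2))"
      unfolding corr_kernel_def R_def[symmetric] by (metis mult.right_neutral times_divide_eq_right)
    then have "corr_kernel \<rho> z w powr (1 + \<theta>) =
       exp (- (\<rho>\<^sup>2 * z\<^sup>2 - 2 * \<rho> * z * w + \<rho>\<^sup>2 * w\<^sup>2) / (2 * R)) powr (1 + \<theta>) * (R powr (- (1 / 2))) powr (1 + \<theta>)"
      by (simp only: powr_mult)
    also have "exp (- (\<rho>\<^sup>2 * z\<^sup>2 - 2 * \<rho> * z * w + \<rho>\<^sup>2 * w\<^sup>2) / (2 * R)) powr (1 + \<theta>) =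
       exp ((- (\<rho>\<^sup>2 * z\<^sup>2 - 2 * \<rho> * z * w + \<rho>\<^sup>2 * w\<^sup>2) / (2 * R)) * (1 + \<theta>))"
      by (simp only: exp_powr_real)
    also have "(R powr (- (1 / 2))) powr (1 + \<theta>) = C"
      unfolding C_def powr_powr by (rule arg_cong[where f = "\<lambda>u. R powr u"]) (simp add: field_simps)
    finally have "corr_kernel \<rho> z w powr (1 + \<theta>) =
       exp ((- (\<rho>\<^sup>2 * z\<^sup>2 - 2 * \<rho> * z * w + \<rho>\<^sup>2 * w\<^sup>2) / (2 * R)) * (1 + \<theta>)) * C" .
    then show ?thesis unfolding e exp_add by (simp add: mult_ac)
  qed
  have C0: "0 \<le> C" by (simp add: C_def)
  have inner: "(\<integral>\<^sup>+w. ennreal (corr_kernel \<rho> z w powr (1 + \<theta>)) \<partial>std_normal) =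
     ennreal (C / sqrt D) * ennreal (exp ((1 - (D\<^sup>2 - \<kappa>\<^sup>2) / D) / 2 * z\<^sup>2 + 0 * z))" for z
  proof -
    have "(\<integral>\<^sup>+w. ennreal (corr_kernel \<rho> z w powr (1 + \<theta>)) \<partial>std_normal) =
      ennreal (C * exp ((1 - D) / 2 * z\<^sup>2)) * ennreal (exp ((\<kappa> * z)\<^sup>2 / (2 * D)) / sqrt D)"
      unfolding pw using C0
      by (subst ennreal_mult, simp, simp, subst nn_integral_cmult, simp)
         (simp only: nn_integral_std_normal_exp_quadratic[OF D])
    also have "\<dots> = ennreal (C / sqrt D * (exp ((1 - D) / 2 * z\<^sup>2) * exp ((\<kappa> * z)\<^sup>2 / (2 * D))))"
      using C0 D by (subst ennreal_mult[symmetric]) (auto simp: mult_ac)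
    also have "exp ((1 - D) / 2 * z\<^sup>2) * exp ((\<kappa> * z)\<^sup>2 / (2 * D)) =
       exp ((1 - (D\<^sup>2 - \<kappa>\<^sup>2) / D) / 2 * z\<^sup>2 + 0 * z)"
      using D unfolding mult_exp_exp by (simp add: power2_eq_square field_simps)
    also have "ennreal (C / sqrt D * exp ((1 - (D\<^sup>2 - \<kappa>\<^sup>2) / D) / 2 * z\<^sup>2 + 0 * z)) =
        ennreal (C / sqrt D) * ennreal (exp ((1 - (D\<^sup>2 - \<kappa>\<^sup>2) / D) / 2 * z\<^sup>2 + 0 * z))"
      using C0 D by (intro ennreal_mult) auto
    finally show ?thesis .
  qed
  have "(\<integral>\<^sup>+z. \<integral>\<^sup>+w. ennreal (corr_kernel \<rho> z w powr (1 + \<theta>)) \<partial>std_normal \<partial>std_normal) =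
     ennreal (C / sqrt D) * ennreal (exp (0\<^sup>2 / (2 * ((D\<^sup>2 - \<kappa>\<^sup>2) / D))) / sqrt ((D\<^sup>2 - \<kappa>\<^sup>2) / D))"
    unfolding inner by (subst nn_integral_cmult, simp)
      (simp only: nn_integral_std_normal_exp_quadratic[OF det_pos])
  also have "\<dots> = ennreal (C / sqrt (D\<^sup>2 - \<kappa>\<^sup>2))"
    using C0 D det_pos by (subst ennreal_mult[symmetric])
      (auto simp: real_sqrt_divide divide_simps)
  also have "C / sqrt (D\<^sup>2 - \<kappa>\<^sup>2) = R powr (- \<theta> / 2) * (1 - \<theta>\<^sup>2 * \<rho>\<^sup>2) powr (- 1 / 2)"
  proof -
    have "C * sqrt R = R powr (- (1 + \<theta>) / 2) * R powr (1 / 2)"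
      using R by (simp only: C_def powr_half_sqrt)
    also have "\<dots> = R powr (- \<theta> / 2)"
      unfolding powr_add[symmetric] by (rule arg_cong[where f = "\<lambda>u. R powr u"]) (simp add: field_simps)
    finally have 1: "C * sqrt R = R powr (- \<theta> / 2)" .
    have "(1 - \<theta>\<^sup>2 * \<rho>\<^sup>2) powr (- (1 / 2)) = 1 / sqrt (1 - \<theta>\<^sup>2 * \<rho>\<^sup>2)"
      using T unfolding powr_minus_divide by (simp only: powr_half_sqrt less_imp_le)
    then have 2: "(1 - \<theta>\<^sup>2 * \<rho>\<^sup>2) powr (- 1 / 2) = 1 / sqrt (1 - \<theta>\<^sup>2 * \<rho>\<^sup>2)"
      by simp
    have "C / sqrt (D\<^sup>2 - \<kappa>\<^sup>2) = (C * sqrt R) / sqrt (1 - \<theta>\<^sup>2 * \<rho>\<^sup>2)"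
      unfolding det by (simp add: real_sqrt_divide)
    then show ?thesis unfolding 1 2 by simp
  qed
  finally show ?thesis by (simp add: R_def)
qed

section \<open>Pairwise kernels on a product of copies of one space\<close>

lemma nn_integral_PiM_split_coordinate:
  assumes G: "prob_space G" and I: "finite I" "j \<in> I"
    and f: "f \<in> borel_measurable (\<Pi>\<^sub>M i\<in>I. G)"
  shows "(\<integral>\<^sup>+x. f x \<partial>(\<Pi>\<^sub>M i\<in>I. G)) = (\<integral>\<^sup>+x. \<integral>\<^sup>+y. f (x(j := y)) \<partial>G \<partial>(\<Pi>\<^sub>M i\<in>I - {j}. G))"
proof -
  interpret product_prob_space "\<lambda>_. G" I by (rule product_prob_spaceI) (rule G)
  have "insert j (I - {j}) = I" using I by auto
  then show ?thesis
    using product_nn_integral_insert[of "I - {j}" j f] I f by simp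
qed

lemma measurable_PiM_pair:
  assumes "case_prod Q \<in> borel_measurable (G \<Otimes>\<^sub>M G)" "i \<in> I" "j \<in> I"
  shows "(\<lambda>x. Q (x i) (x j)) \<in> borel_measurable (\<Pi>\<^sub>M i\<in>I. G)"
proof -
  have "(\<lambda>x. (x i, x j)) \<in> (\<Pi>\<^sub>M i\<in>I. G) \<rightarrow>\<^sub>M G \<Otimes>\<^sub>M G"
    using assms by (intro measurable_Pair measurable_component_singleton)
  from measurable_compose[OF this assms(1)] show ?thesis by simp
qed

lemma nn_integral_PiM_pair:
  fixes f :: "'a \<Rightarrow> 'a \<Rightarrow> ennreal"
  assumes G: "prob_space G" and I: "finite I" "i \<in> I" "j \<in> I" "i \<noteq> j"
    and f: "case_prod f \<in> borel_measurable (G \<Otimes>\<^sub>M G)"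
  shows "(\<integral>\<^sup>+x. f (x i) (x j) \<partial>(\<Pi>\<^sub>M i\<in>I. G)) = (\<integral>\<^sup>+z. \<integral>\<^sup>+w. f z w \<partial>G \<partial>G)"
proof -
  interpret G: prob_space G by fact
  have "(\<integral>\<^sup>+x. f (x i) (x j) \<partial>(\<Pi>\<^sub>M i\<in>I. G)) = (\<integral>\<^sup>+x. \<integral>\<^sup>+w. f (x i) w \<partial>G \<partial>(\<Pi>\<^sub>M i\<in>I - {j}. G))"
    using nn_integral_PiM_split_coordinate[OF G I(1,3) measurable_PiM_pair[OF f I(2,3)]] I by simp
  also have "\<dots> = (\<integral>\<^sup>+z. \<integral>\<^sup>+w. f z w \<partial>G \<partial>distr (\<Pi>\<^sub>M i\<in>I - {j}. G) G (\<lambda>x. x i))"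
    using I f by (intro nn_integral_distr[symmetric] G.borel_measurable_nn_integral measurable_component_singleton) auto
  also have "distr (\<Pi>\<^sub>M i\<in>I - {j}. G) G (\<lambda>x. x i) = G"
    using I G by (intro distr_PiM_component) auto
  finally show ?thesis .
qed

text \<open>A kernel with unit marginals disappears once the rest of the integrand does not see
one of its two coordinates.\<close>
lemma nn_integral_PiM_integrate_out:
  fixes Q :: "'a \<Rightarrow> 'a \<Rightarrow> ennreal"
  assumes G: "prob_space G" and I: "finite I" "i \<in> I" "j \<in> I" "i \<noteq> j"
    and Q: "case_prod Q \<in> borel_measurable (G \<Otimes>\<^sub>M G)"
    and one: "\<And>z. z \<in> space G \<Longrightarrow> (\<integral>\<^sup>+w. Q z w \<partial>G) = 1"
    and h: "h \<in> borel_measurable (\<Pi>\<^sub>M i\<in>I. G)" "\<And>x y. h (x(j := y)) = h x"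
  shows "(\<integral>\<^sup>+x. h x * Q (x i) (x j) \<partial>(\<Pi>\<^sub>M i\<in>I. G)) = (\<integral>\<^sup>+x. h x \<partial>(\<Pi>\<^sub>M i\<in>I. G))"
proof -
  interpret G: prob_space G by fact
  have "(\<integral>\<^sup>+x. h x * Q (x i) (x j) \<partial>(\<Pi>\<^sub>M i\<in>I. G)) =
      (\<integral>\<^sup>+x. \<integral>\<^sup>+y. h x * Q (x i) y \<partial>G \<partial>(\<Pi>\<^sub>M i\<in>I - {j}. G))"
    using I h
    by (subst nn_integral_PiM_split_coordinate[OF G I(1,3)])
       (auto intro!: borel_measurable_times_ennreal measurable_PiM_pair[OF Q])
  also have "\<dots> = (\<integral>\<^sup>+x. \<integral>\<^sup>+y. h x \<partial>G \<partial>(\<Pi>\<^sub>M i\<in>I - {j}. G))"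
  proof (rule nn_integral_cong)
    fix x assume "x \<in> space (\<Pi>\<^sub>M i\<in>I - {j}. G)"
    then have xi: "x i \<in> space G" using I by (auto simp: space_PiM PiE_iff)
    have "(\<lambda>y. Q (x i) y) \<in> borel_measurable G"
      using measurable_compose[OF measurable_Pair1'[OF xi] Q] by simp
    then show "(\<integral>\<^sup>+y. h x * Q (x i) y \<partial>G) = (\<integral>\<^sup>+y. h x \<partial>G)"
      by (simp add: nn_integral_cmult one[OF xi] G.emeasure_space_1)
  qed
  also have "\<dots> = (\<integral>\<^sup>+x. h x \<partial>(\<Pi>\<^sub>M i\<in>I. G))"
    using h by (subst nn_integral_PiM_split_coordinate[OF G I(1,3), of h]) auto
  finally show ?thesis .
qed

text \<open>Two different pairs differ in some coordinate; integrating it out removes the kernel that contains it.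
Symmetry of the kernel allows this coordinate to be either entry of the pair.\<close>
lemma nn_integral_PiM_two_pairs:
  fixes Q :: "'a \<Rightarrow> 'a \<Rightarrow> ennreal"
  assumes G: "prob_space G" and I: "finite I" "i \<in> I" "j \<in> I" "k \<in> I" "l \<in> I"
    and ne: "i \<noteq> j" "k \<noteq> l" "{i, j} \<noteq> {k, l}"
    and Q: "case_prod Q \<in> borel_measurable (G \<Otimes>\<^sub>M G)" and sym: "\<And>z w. Q z w = Q w z"
    and one: "\<And>z. z \<in> space G \<Longrightarrow> (\<integral>\<^sup>+w. Q z w \<partial>G) = 1"
  shows "(\<integral>\<^sup>+x. Q (x i) (x j) * Q (x k) (x l) \<partial>(\<Pi>\<^sub>M i\<in>I. G)) = 1"
proof -
  interpret P: prob_space "\<Pi>\<^sub>M i\<in>I. G" using G by (intro prob_space_PiM)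
  have single: "(\<integral>\<^sup>+x. Q (x k) (x l) \<partial>(\<Pi>\<^sub>M i\<in>I. G)) = 1"
    using nn_integral_PiM_integrate_out[OF G I(1,4,5) ne(2) Q one, of "\<lambda>_. 1"]
    by (simp add: P.emeasure_space_1)
  have *: "(\<integral>\<^sup>+x. Q (x k) (x l) * Q (x a) (x b) \<partial>(\<Pi>\<^sub>M i\<in>I. G)) = 1"
    if "a \<in> I" "b \<in> I" "a \<noteq> b" "b \<notin> {k, l}" for a b
  proof -
    have "Q ((x(b := y)) k) ((x(b := y)) l) = Q (x k) (x l)" for x y using that by auto
    from nn_integral_PiM_integrate_out[OF G I(1) that(1-3) Q one measurable_PiM_pair[OF Q I(4,5)] this]
    show ?thesis by (simp add: single)
  qed
  show ?thesis
  proof (cases "j \<in> {k, l}")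
    case False
    then show ?thesis using *[of i j] I ne by (simp add: mult.commute)
  next
    case True
    then have "i \<notin> {k, l}" using ne by auto
    then show ?thesis using *[of j i] I ne by (simp add: mult.commute sym[of "x j" "x i" for x])
  qed
qed

text \<open>If \<open>T z\<close> realizes the density \<open>Q z\<close> as a transformation of \<open>G\<close>, then tilting the product by the
kernel of the coordinates \<open>i, j\<close> is the same as transforming coordinate \<open>j\<close> with the help of \<open>i\<close>.\<close>
lemma density_PiM_pair_kernel:
  fixes Q :: "'a \<Rightarrow> 'a \<Rightarrow> ennreal"
  assumes G: "prob_space G" and I: "finite I" "i \<in> I" "j \<in> I" "i \<noteq> j"
    and Q: "case_prod Q \<in> borel_measurable (G \<Otimes>\<^sub>M G)"
    and T: "case_prod T \<in> G \<Otimes>\<^sub>M G \<rightarrow>\<^sub>M G"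
    and dens: "\<And>z. z \<in> space G \<Longrightarrow> density G (Q z) = distr G G (T z)"
  shows "density (\<Pi>\<^sub>M i\<in>I. G) (\<lambda>x. Q (x i) (x j)) =
    distr (\<Pi>\<^sub>M i\<in>I. G) (\<Pi>\<^sub>M i\<in>I. G) (\<lambda>x. \<lambda>a\<in>I. if a = j then T (x i) (x j) else x a)"
    (is "?D = distr ?P ?P ?F")
proof (rule measure_eqI)
  interpret G: prob_space G by fact
  have Tm: "(\<lambda>x. T (x i) (x j)) \<in> ?P \<rightarrow>\<^sub>M G"
  proof -
    have "(\<lambda>x. (x i, x j)) \<in> ?P \<rightarrow>\<^sub>M G \<Otimes>\<^sub>M G"
      using I by (intro measurable_Pair measurable_component_singleton)
    from measurable_compose[OF this T] show ?thesis by simp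
  qed
  have F: "?F \<in> ?P \<rightarrow>\<^sub>M ?P"
  proof (rule measurable_restrict)
    fix a assume "a \<in> I"
    then show "(\<lambda>x. if a = j then T (x i) (x j) else x a) \<in> ?P \<rightarrow>\<^sub>M G"
      using Tm by (cases "a = j") auto
  qed
  fix A assume "A \<in> sets ?D"
  then have A: "A \<in> sets ?P" by simp
  have "emeasure ?D A = (\<integral>\<^sup>+x. Q (x i) (x j) * indicator A x \<partial>?P)"
    using A I by (intro emeasure_density measurable_PiM_pair[OF Q])
  also have "\<dots> = (\<integral>\<^sup>+x. \<integral>\<^sup>+y. Q (x i) y * indicator A (x(j := y)) \<partial>G \<partial>(\<Pi>\<^sub>M i\<in>I - {j}. G))"
    using I A by (subst nn_integral_PiM_split_coordinate[OF G I(1,3)])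
      (auto intro!: borel_measurable_times_ennreal measurable_PiM_pair[OF Q])
  also have "\<dots> = (\<integral>\<^sup>+x. \<integral>\<^sup>+y. indicator A (x(j := T (x i) y)) \<partial>G \<partial>(\<Pi>\<^sub>M i\<in>I - {j}. G))"
  proof (rule nn_integral_cong)
    fix x assume x: "x \<in> space (\<Pi>\<^sub>M i\<in>I - {j}. G)"
    then have xi: "x i \<in> space G" using I by (auto simp: space_PiM PiE_iff)
    have Qx: "Q (x i) \<in> borel_measurable G"
      using measurable_compose[OF measurable_Pair1'[OF xi] Q] by simp
    have Tx: "T (x i) \<in> G \<rightarrow>\<^sub>M G"
      using measurable_compose[OF measurable_Pair1'[OF xi] T] by simp
    have "(\<lambda>y. x(j := y)) \<in> G \<rightarrow>\<^sub>M ?P"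
      using I x by (intro measurable_fun_upd[where J = "I - {j}"]) auto
    then have Ax: "(\<lambda>y. indicator A (x(j := y)) :: ennreal) \<in> borel_measurable G"
      by (rule measurable_compose[OF _ borel_measurable_indicator[OF A]])
    have "(\<integral>\<^sup>+y. Q (x i) y * indicator A (x(j := y)) \<partial>G) =
        (\<integral>\<^sup>+y. indicator A (x(j := y)) \<partial>density G (Q (x i)))"
      by (rule nn_integral_density[symmetric, OF Qx Ax])
    also have "\<dots> = (\<integral>\<^sup>+y. indicator A (x(j := T (x i) y)) \<partial>G)"
      unfolding dens[OF xi] using Ax by (intro nn_integral_distr[OF Tx]) simp
    finally show "(\<integral>\<^sup>+y. Q (x i) y * indicator A (x(j := y)) \<partial>G) =
        (\<integral>\<^sup>+y. indicator A (x(j := T (x i) y)) \<partial>G)" .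
  qed
  also have "\<dots> = (\<integral>\<^sup>+x. \<integral>\<^sup>+y. indicator A (?F (x(j := y))) \<partial>G \<partial>(\<Pi>\<^sub>M i\<in>I - {j}. G))"
  proof (intro nn_integral_cong arg_cong[where f = "indicator A"] ext)
    fix x y a assume "x \<in> space (\<Pi>\<^sub>M i\<in>I - {j}. G)"
    then show "(x(j := T (x i) y)) a = ?F (x(j := y)) a"
      using I by (auto simp: space_PiM PiE_iff extensional_def)
  qed
  also have "\<dots> = (\<integral>\<^sup>+x. indicator A (?F x) \<partial>?P)"
    using A by (intro nn_integral_PiM_split_coordinate[OF G I(1,3), symmetric] measurable_compose[OF F]) simp
  also have "\<dots> = emeasure (distr ?P ?P ?F) A"
    using A by (subst nn_integral_distr[OF F, symmetric]) auto
  finally show "emeasure ?D A = emeasure (distr ?P ?P ?F) A" .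
qed simp

section \<open>The truncated second moment method\<close>

lemma (in prob_space) abs_expectation_le_sqrt_second_moment:
  fixes Y :: "'a \<Rightarrow> real"
  assumes "integrable M Y" "integrable M (\<lambda>x. (Y x)\<^sup>2)"
  shows "expectation (\<lambda>x. \<bar>Y x\<bar>) \<le> sqrt (expectation (\<lambda>x. (Y x)\<^sup>2))"
proof (rule real_le_rsqrt)
  have "0 \<le> variance (\<lambda>x. \<bar>Y x\<bar>)" by (rule variance_positive)
  also have "\<dots> = expectation (\<lambda>x. (Y x)\<^sup>2) - (expectation (\<lambda>x. \<bar>Y x\<bar>))\<^sup>2"
    using assms by (subst variance_eq) auto
  finally show "(expectation (\<lambda>x. \<bar>Y x\<bar>))\<^sup>2 \<le> expectation (\<lambda>x. (Y x)\<^sup>2)" by simp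
qed

text \<open>The average of the densities \<open>L j\<close> is compared with the constant 1. Each \<open>L j\<close> is split into its part
\<open>T j\<close> below the level \<open>K\<close> and the excess \<open>U j\<close>, whose mass is at most \<open>\<eta>\<close>. The average \<open>S\<close> of
the truncated densities has mean at least \<open>1 - \<eta>\<close>. In its second moment the off-diagonal terms
contribute at most 1, since truncation only decreases the products, and the diagonal terms contribute
at most \<open>K\<close> divided by the number of densities. Thus \<open>S\<close> is close to 1 in mean square, hence in mean, and changes the
probability of every event by little.\<close>
lemma (in prob_space) average_density_measure_le:
  fixes L :: "'j \<Rightarrow> 'a \<Rightarrow> real"
  assumes J: "finite J" "J \<noteq> {}"
    and meas[measurable]: "\<And>j. j \<in> J \<Longrightarrow> L j \<in> borel_measurable M"
    and nonneg: "\<And>j x. j \<in> J \<Longrightarrow> 0 \<le> L j x"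
    and total: "\<And>j. j \<in> J \<Longrightarrow> (\<integral>\<^sup>+x. ennreal (L j x) \<partial>M) = 1"
    and pair: "\<And>j k. j \<in> J \<Longrightarrow> k \<in> J \<Longrightarrow> j \<noteq> k \<Longrightarrow> (\<integral>\<^sup>+x. ennreal (L j x) * ennreal (L k x) \<partial>M) \<le> 1"
    and K: "0 \<le> K" and \<eta>: "0 \<le> \<eta>"
    and tail: "\<And>j. j \<in> J \<Longrightarrow> (\<integral>\<^sup>+x. ennreal (L j x) * indicator {x. K < L j x} x \<partial>M) \<le> ennreal \<eta>"
    and A[measurable]: "A \<in> sets M"
  shows "(\<Sum>j\<in>J. measure (density M (\<lambda>x. ennreal (L j x))) A) / card J
     \<le> prob A + \<eta> + sqrt (2 * \<eta> + K / card J)"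
proof -
  define N where "N = real (card J)"
  have N: "N > 0" using J by (simp add: N_def card_gt_0_iff)
  define T where "T j x = L j x * indicator {x. L j x \<le> K} x" for j x
  define U where "U j x = L j x * indicator {x. K < L j x} x" for j x
  have [measurable]: "T j \<in> borel_measurable M" "U j \<in> borel_measurable M" if "j \<in> J" for j
    using that unfolding T_def U_def indicator_def by measurable
  have split: "L j x = T j x + U j x" for j x
    by (auto simp: T_def U_def indicator_def)
  have T0: "0 \<le> T j x" "T j x \<le> K" "T j x \<le> L j x" if "j \<in> J" for j x
    using nonneg[OF that, of x] K by (auto simp: T_def indicator_def)
  have U0: "0 \<le> U j x" if "j \<in> J" for j x
    using nonneg[OF that, of x] by (auto simp: U_def indicator_def)
  have intT: "integrable M (T j)" if "j \<in> J" for j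
    using T0[OF that] that by (intro integrable_const_bound[where B=K]) auto
  have intL: "integrable M (L j)" and EL: "expectation (L j) = 1" if "j \<in> J" for j
  proof -
    show "integrable M (L j)"
      using that nonneg total by (intro integrableI_nonneg) auto
    show "expectation (L j) = 1"
      using that nonneg total by (subst integral_eq_nn_integral) auto
  qed
  have intU: "integrable M (U j)" if "j \<in> J" for j
  proof -
    have "U j = (\<lambda>x. L j x - T j x)" by (rule ext) (simp add: split)
    then show ?thesis using intL intT that by auto
  qed
  have EU: "expectation (U j) \<le> \<eta>" if "j \<in> J" for j
  proof -
    have "ennreal (U j x) = ennreal (L j x) * indicator {x. K < L j x} x" for x
      by (auto simp: U_def indicator_def)
    then have "ennreal (expectation (U j)) \<le> ennreal \<eta>"
      using tail[OF that] by (subst nn_integral_eq_integral[symmetric, OF intU[OF that]])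
        (auto simp: U0 that)
    then show ?thesis using \<eta> by simp
  qed
  have ET: "1 - \<eta> \<le> expectation (T j)" "expectation (T j) \<le> 1" if "j \<in> J" for j
  proof -
    have "L j = (\<lambda>x. T j x + U j x)" by (rule ext) (rule split)
    then have "1 = expectation (T j) + expectation (U j)"
      using EL[OF that] intT[OF that] intU[OF that] by simp
    moreover have "0 \<le> expectation (U j)" using U0 that by simp
    ultimately show "1 - \<eta> \<le> expectation (T j)" "expectation (T j) \<le> 1"
      using EU[OF that] by auto
  qed
  have intTT: "integrable M (\<lambda>x. T j x * T k x)" if "j \<in> J" "k \<in> J" for j k
  proof (rule integrable_const_bound[where B = "K * K"])
    show "AE x in M. norm (T j x * T k x) \<le> K * K"
      using T0[OF that(1)] T0[OF that(2)] by (intro AE_I2) (auto intro!: mult_mono K)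
  qed (use that in auto)
  have ETT: "expectation (\<lambda>x. T j x * T k x) \<le> 1" if "j \<in> J" "k \<in> J" "j \<noteq> k" for j k
  proof -
    have "ennreal (expectation (\<lambda>x. T j x * T k x)) = (\<integral>\<^sup>+x. ennreal (T j x * T k x) \<partial>M)"
      using that by (intro nn_integral_eq_integral[symmetric] intTT) (auto intro!: mult_nonneg_nonneg T0)
    also have "\<dots> \<le> (\<integral>\<^sup>+x. ennreal (L j x) * ennreal (L k x) \<partial>M)"
      using that T0[OF that(1)] T0[OF that(2)] nonneg
      by (intro nn_integral_mono) (auto simp flip: ennreal_mult intro!: ennreal_leI mult_mono)
    also have "\<dots> \<le> 1" by (rule pair) fact+
    finally show ?thesis by simp
  qed
  have ETsq: "expectation (\<lambda>x. T j x * T j x) \<le> K" if "j \<in> J" for j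
  proof -
    have "expectation (\<lambda>x. T j x * T j x) \<le> expectation (\<lambda>x. K * T j x)"
      using that T0[OF that] by (intro integral_mono intTT) (auto intro!: mult_right_mono intT)
    also have "\<dots> \<le> K * 1" using ET(2)[OF that] K by (simp add: mult_left_le)
    finally show ?thesis by simp
  qed
  define S where "S x = (\<Sum>j\<in>J. T j x) / N" for x
  have [measurable]: "S \<in> borel_measurable M" unfolding S_def[abs_def] by measurable
  have intS: "integrable M S" unfolding S_def[abs_def] using intT by auto
  have ES: "1 - \<eta> \<le> expectation S"
  proof -
    have "(1 - \<eta>) * N = (\<Sum>j\<in>J. 1 - \<eta>)" by (simp add: N_def)
    also have "\<dots> \<le> (\<Sum>j\<in>J. expectation (T j))" by (intro sum_mono ET)
    also have "\<dots> = expectation S * N" using N intT by (simp add: S_def[abs_def])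
    finally show ?thesis using N by simp
  qed
  have sq: "(S x)\<^sup>2 = (\<Sum>j\<in>J. \<Sum>k\<in>J. T j x * T k x) / N\<^sup>2" for x
    by (simp add: S_def power_divide power2_eq_square sum_product)
  have intSS: "integrable M (\<lambda>x. (S x)\<^sup>2)" unfolding sq using intTT by auto
  have ESS: "expectation (\<lambda>x. (S x)\<^sup>2) \<le> 1 + K / N"
  proof -
    have "expectation (\<lambda>x. (S x)\<^sup>2) * N\<^sup>2 = (\<Sum>j\<in>J. \<Sum>k\<in>J. expectation (\<lambda>x. T j x * T k x))"
      using N intTT by (simp add: sq)
    also have "\<dots> \<le> (\<Sum>j\<in>J. \<Sum>k\<in>J. (if j = k then K else 0) + 1)"
    proof (intro sum_mono)
      fix j k assume "j \<in> J" "k \<in> J"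
      then show "expectation (\<lambda>x. T j x * T k x) \<le> (if j = k then K else 0) + 1"
        using ETT[of j k] ETsq[of j] by (cases "j = k") auto
    qed
    also have "\<dots> = N * K + N * N"
      using J by (simp add: sum.distrib N_def ring_distribs)
    also have "\<dots> = (1 + K / N) * N\<^sup>2" using N by (simp add: power2_eq_square field_simps)
    finally show ?thesis using N by simp
  qed
  have intY: "integrable M (\<lambda>x. (S x - 1)\<^sup>2)"
    using intS intSS by (simp add: power2_diff)
  have "expectation (\<lambda>x. (S x - 1)\<^sup>2) = expectation (\<lambda>x. (S x)\<^sup>2) - 2 * expectation S + 1"
    using intS intSS by (simp add: power2_diff prob_space)
  also have "\<dots> \<le> 2 * \<eta> + K / N" using ESS ES by simp
  finally have var: "expectation (\<lambda>x. (S x - 1)\<^sup>2) \<le> 2 * \<eta> + K / N" .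
  have "expectation (\<lambda>x. \<bar>S x - 1\<bar>) \<le> sqrt (expectation (\<lambda>x. (S x - 1)\<^sup>2))"
    using intS intY by (intro abs_expectation_le_sqrt_second_moment) auto
  also have "\<dots> \<le> sqrt (2 * \<eta> + K / N)" using var by simp
  finally have L1: "expectation (\<lambda>x. \<bar>S x - 1\<bar>) \<le> sqrt (2 * \<eta> + K / N)" .
  have intA: "integrable M (\<lambda>x. f x * indicator A x)" if "integrable M f" for f :: "'a \<Rightarrow> real"
    using integrable_mult_indicator[OF A that] by (simp add: mult.commute)
  have dens: "measure (density M (\<lambda>x. ennreal (L j x))) A \<le> expectation (\<lambda>x. T j x * indicator A x) + \<eta>"
    if "j \<in> J" for j
  proof -
    have "measure (density M (\<lambda>x. ennreal (L j x))) A = expectation (\<lambda>x. L j x * indicator A x)"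
    proof -
      have "emeasure (density M (\<lambda>x. ennreal (L j x))) A = (\<integral>\<^sup>+x. ennreal (L j x) * indicator A x \<partial>M)"
        using that by (intro emeasure_density) auto
      also have "\<dots> = (\<integral>\<^sup>+x. ennreal (L j x * indicator A x) \<partial>M)"
        by (intro nn_integral_cong) (auto simp: indicator_def)
      also have "\<dots> = ennreal (expectation (\<lambda>x. L j x * indicator A x))"
        using that nonneg by (intro nn_integral_eq_integral intA intL) auto
      finally show ?thesis
        using that nonneg by (simp add: measure_def integral_nonneg)
    qed
    also have "\<dots> = expectation (\<lambda>x. T j x * indicator A x) + expectation (\<lambda>x. U j x * indicator A x)"
      using that intA intT intU by (simp add: split ring_distribs)
    also have "expectation (\<lambda>x. U j x * indicator A x) \<le> expectation (U j)"
      using that U0 by (intro integral_mono intA intU) (auto simp: indicator_def)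
    also have "\<dots> \<le> \<eta>" by (rule EU) fact
    finally show ?thesis by simp
  qed
  have "(\<Sum>j\<in>J. measure (density M (\<lambda>x. ennreal (L j x))) A) / N
     \<le> (\<Sum>j\<in>J. expectation (\<lambda>x. T j x * indicator A x) + \<eta>) / N"
    using N by (intro divide_right_mono sum_mono dens) auto
  also have "\<dots> = expectation (\<lambda>x. S x * indicator A x) + \<eta>"
    using N intA intT by (simp add: S_def sum.distrib add_divide_distrib sum_distrib_right N_def[symmetric])
  also have "expectation (\<lambda>x. S x * indicator A x) \<le> expectation (\<lambda>x. indicator A x + \<bar>S x - 1\<bar>)"
  proof (rule integral_mono)
    show "integrable M (\<lambda>x. S x * indicator A x)" by (rule intA[OF intS])
    show "integrable M (\<lambda>x. indicator A x + \<bar>S x - 1\<bar>)"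
      using intS by (intro Bochner_Integration.integrable_add integrable_real_indicator)
        (auto simp: emeasure_eq_measure)
  qed (auto simp: indicator_def)
  also have "\<dots> = prob A + expectation (\<lambda>x. \<bar>S x - 1\<bar>)"
    using intS by (subst Bochner_Integration.integral_add) (auto simp: emeasure_eq_measure)
  finally show ?thesis using L1 by (simp add: N_def)
qed

section \<open>Standard normal rows and the matrix normal law\<close>

text \<open>The rows are kept as separate coordinates of an outer product, so that the statements on pairwise kernels
apply with whole rows as coordinates.\<close>
definition row_law :: "nat \<Rightarrow> (nat \<Rightarrow> real) measure" where
  "row_law p = (\<Pi>\<^sub>M r\<in>{..<p}. std_normal)"

definition row_kernel :: "real \<Rightarrow> nat \<Rightarrow> (nat \<Rightarrow> real) \<Rightarrow> (nat \<Rightarrow> real) \<Rightarrow> real" where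
  "row_kernel \<rho> p z w = (\<Prod>r<p. corr_kernel \<rho> (z r) (w r))"

definition std_rows :: "nat \<Rightarrow> nat \<Rightarrow> (nat \<Rightarrow> nat \<Rightarrow> real) measure" where
  "std_rows n p = (\<Pi>\<^sub>M i\<in>{..<n}. row_law p)"

lemma prob_space_row_law: "prob_space (row_law p)"
  unfolding row_law_def by (intro prob_space_PiM prob_space_std_normal)

lemma prob_space_std_rows: "prob_space (std_rows n p)"
  unfolding std_rows_def by (intro prob_space_PiM prob_space_row_law)

lemma row_law_component[measurable (raw)]:
  assumes "r < p" "f \<in> M \<rightarrow>\<^sub>M row_law p"
  shows "(\<lambda>x. f x r) \<in> borel_measurable M"
proof -
  have "(\<lambda>z. z r) \<in> row_law p \<rightarrow>\<^sub>M std_normal"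
    unfolding row_law_def using assms by (intro measurable_component_singleton) auto
  then have "(\<lambda>z. z r) \<in> row_law p \<rightarrow>\<^sub>M borel" by (simp cong: measurable_cong_sets)
  from measurable_compose[OF assms(2) this] show ?thesis .
qed

lemma std_rows_component:
  assumes "i < n"
  shows "(\<lambda>x. x i) \<in> std_rows n p \<rightarrow>\<^sub>M row_law p"
  unfolding std_rows_def using assms by (intro measurable_component_singleton) auto

lemma std_rows_entry:
  assumes "i < n" "r < p"
  shows "(\<lambda>x. x i r) \<in> borel_measurable (std_rows n p)"
  by (rule row_law_component[OF assms(2) std_rows_component[OF assms(1)]])

lemma row_kernel_commute: "row_kernel \<rho> p z w = row_kernel \<rho> p w z"
  by (simp add: row_kernel_def corr_kernel_commute)

lemma row_kernel_pos: "\<bar>\<rho>\<bar> < 1 \<Longrightarrow> 0 < row_kernel \<rho> p z w"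
  by (simp add: row_kernel_def corr_kernel_pos prod_pos)

lemma measurable_row_kernel[measurable]:
  assumes [measurable]: "f \<in> M \<rightarrow>\<^sub>M row_law p" "g \<in> M \<rightarrow>\<^sub>M row_law p"
  shows "(\<lambda>x. row_kernel \<rho> p (f x) (g x)) \<in> borel_measurable M"
  unfolding row_kernel_def by (intro borel_measurable_prod measurable_corr_kernel) auto

lemma nn_integral_row_law_prod:
  assumes "\<And>r. r < p \<Longrightarrow> f r \<in> borel_measurable borel"
  shows "(\<integral>\<^sup>+w. (\<Prod>r<p. f r (w r)) \<partial>row_law p) = (\<Prod>r<p. \<integral>\<^sup>+y. f r y \<partial>std_normal)"
proof -
  interpret product_prob_space "\<lambda>_::nat. std_normal" "{..<p}"
    by (rule product_prob_spaceI) (rule prob_space_std_normal)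
  show ?thesis unfolding row_law_def
    using assms by (intro product_nn_integral_prod) (auto cong: measurable_cong_sets)
qed

lemma nn_integral_row_kernel:
  assumes "\<bar>\<rho>\<bar> < 1"
  shows "(\<integral>\<^sup>+w. ennreal (row_kernel \<rho> p z w) \<partial>row_law p) = 1"
proof -
  have "(\<integral>\<^sup>+w. ennreal (row_kernel \<rho> p z w) \<partial>row_law p) =
      (\<integral>\<^sup>+w. (\<Prod>r<p. ennreal (corr_kernel \<rho> (z r) (w r))) \<partial>row_law p)"
    using corr_kernel_pos[OF assms] by (simp add: row_kernel_def prod_ennreal less_imp_le)
  also have "\<dots> = 1"
    by (subst nn_integral_row_law_prod) (auto simp: nn_integral_corr_kernel[OF assms])
  finally show ?thesis .
qed

lemma nn_integral_row_kernel_powr: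
  assumes r: "\<bar>\<rho>\<bar> < 1" and th: "0 \<le> \<theta>" "\<theta> \<le> 1"
  shows "(\<integral>\<^sup>+z. \<integral>\<^sup>+w. ennreal (row_kernel \<rho> p z w powr (1 + \<theta>)) \<partial>row_law p \<partial>row_law p) =
    ennreal (((1 - \<rho>\<^sup>2) powr (- \<theta> / 2) * (1 - \<theta>\<^sup>2 * \<rho>\<^sup>2) powr (- 1 / 2)) ^ p)"
proof -
  interpret std: prob_space std_normal by (rule prob_space_std_normal)
  define h where "h z w = ennreal (corr_kernel \<rho> z w powr (1 + \<theta>))" for z w
  have h[measurable]: "case_prod h \<in> borel_measurable (borel \<Otimes>\<^sub>M borel)"
    unfolding h_def split_beta by measurable
  have h': "case_prod h \<in> borel_measurable (borel \<Otimes>\<^sub>M std_normal)"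
    using h by (simp cong: measurable_cong_sets sets_pair_measure_cong)
  have eq: "ennreal (row_kernel \<rho> p z w powr (1 + \<theta>)) = (\<Prod>r<p. h (z r) (w r))" for z w
    unfolding h_def row_kernel_def by (simp add: prod_powr_distrib prod_ennreal)
  have "(\<integral>\<^sup>+z. \<integral>\<^sup>+w. ennreal (row_kernel \<rho> p z w powr (1 + \<theta>)) \<partial>row_law p \<partial>row_law p) =
     (\<integral>\<^sup>+z. (\<Prod>r<p. \<integral>\<^sup>+y. h (z r) y \<partial>std_normal) \<partial>row_law p)"
    unfolding eq by (subst nn_integral_row_law_prod) auto
  also have "\<dots> = (\<Prod>r<p. \<integral>\<^sup>+x. \<integral>\<^sup>+y. h x y \<partial>std_normal \<partial>std_normal)"
    by (rule nn_integral_row_law_prod) (rule std.borel_measurable_nn_integral[OF h'])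
  also have "\<dots> = ennreal (((1 - \<rho>\<^sup>2) powr (- \<theta> / 2) * (1 - \<theta>\<^sup>2 * \<rho>\<^sup>2) powr (- 1 / 2)) ^ p)"
    unfolding h_def nn_integral_corr_kernel_powr[OF assms] by (simp add: ennreal_power)
  finally show ?thesis .
qed

text \<open>Both measures are products over the entries of the row, so that they are compared on boxes,
where the one-dimensional statement applies in each factor.\<close>
lemma density_row_kernel:
  assumes r: "\<bar>\<rho>\<bar> < 1"
  shows "density (row_law p) (\<lambda>w. ennreal (row_kernel \<rho> p z w)) =
    distr (row_law p) (row_law p) (\<lambda>w. \<lambda>r\<in>{..<p}. \<rho> * z r + sqrt (1 - \<rho>\<^sup>2) * w r)"
    (is "?D = distr _ _ ?F")
proof (rule measure_eqI_PiM_finite[where I = "{..<p}" and M = "\<lambda>_. std_normal"])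
  interpret product_prob_space "\<lambda>_::nat. std_normal" "{..<p}"
    by (rule product_prob_spaceI) (rule prob_space_std_normal)
  interpret row: prob_space "row_law p" by (rule prob_space_row_law)
  have F: "?F \<in> row_law p \<rightarrow>\<^sub>M row_law p"
    unfolding row_law_def by (rule measurable_restrict) (simp, measurable)
  fix A :: "nat \<Rightarrow> real set"
  assume "\<And>i. i \<in> {..<p} \<Longrightarrow> A i \<in> sets std_normal"
  then have A: "A r \<in> sets borel" if "r < p" for r using that by simp
  have box: "Pi\<^sub>E {..<p} A \<in> sets (row_law p)"
    unfolding row_law_def using A by (intro sets_PiM_I_finite) auto
  let ?g = "\<lambda>r y. \<rho> * z r + sqrt (1 - \<rho>\<^sup>2) * y"
  have "emeasure ?D (Pi\<^sub>E {..<p} A) = (\<integral>\<^sup>+w. (\<Prod>r<p. ennreal (corr_kernel \<rho> (z r) (w r)) * indicator (A r) (w r)) \<partial>row_law p)"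
  proof -
    have "emeasure ?D (Pi\<^sub>E {..<p} A) =
        (\<integral>\<^sup>+w. ennreal (row_kernel \<rho> p z w) * indicator (Pi\<^sub>E {..<p} A) w \<partial>row_law p)"
      unfolding row_kernel_def 
      by (rule emeasure_density[OF _ box]) (intro measurable_compose[OF _ measurable_ennreal] borel_measurable_prod measurable_corr_kernel, auto)
    also have "\<dots> = (\<integral>\<^sup>+w. (\<Prod>r<p. ennreal (corr_kernel \<rho> (z r) (w r)) * indicator (A r) (w r)) \<partial>row_law p)"
    proof (rule nn_integral_cong)
      fix w assume "w \<in> space (row_law p)"
      then have "w \<in> extensional {..<p}" by (simp add: row_law_def space_PiM PiE_iff)
      then have "indicator (Pi\<^sub>E {..<p} A) w = (\<Prod>r<p. indicator (A r) (w r) :: ennreal)"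
        by (auto simp: indicator_def PiE_iff prod_zero_iff)
      then show "ennreal (row_kernel \<rho> p z w) * indicator (Pi\<^sub>E {..<p} A) w =
          (\<Prod>r<p. ennreal (corr_kernel \<rho> (z r) (w r)) * indicator (A r) (w r))"
        using corr_kernel_pos[OF r]
        by (simp add: row_kernel_def prod_ennreal less_imp_le prod.distrib)
    qed
    finally show ?thesis .
  qed
  also have "\<dots> = (\<Prod>r<p. \<integral>\<^sup>+y. ennreal (corr_kernel \<rho> (z r) y) * indicator (A r) y \<partial>std_normal)"
    using A by (intro nn_integral_row_law_prod) auto
  also have "\<dots> = (\<Prod>r<p. emeasure std_normal (?g r -` A r))"
  proof (rule prod.cong[OF refl])
    fix r assume "r \<in> {..<p}"
    then have Ar: "A r \<in> sets borel" using A by simp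
    have "(\<integral>\<^sup>+y. ennreal (corr_kernel \<rho> (z r) y) * indicator (A r) y \<partial>std_normal) =
        emeasure (density std_normal (\<lambda>w. ennreal (corr_kernel \<rho> (z r) w))) (A r)"
      using Ar by (subst emeasure_density) auto
    also have "\<dots> = emeasure std_normal (?g r -` A r)"
      unfolding distr_std_normal_corr_kernel[OF assms] using Ar
      by (subst emeasure_distr) auto
    finally show "(\<integral>\<^sup>+y. ennreal (corr_kernel \<rho> (z r) y) * indicator (A r) y \<partial>std_normal) =
        emeasure std_normal (?g r -` A r)" .
  qed
  also have "\<dots> = emeasure (row_law p) (Pi\<^sub>E {..<p} (\<lambda>r. ?g r -` A r))"
    unfolding row_law_def
  proof (rule emeasure_PiM[symmetric])
    fix r assume "r \<in> {..<p}"
    then have "A r \<in> sets borel" using A by simp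
    then have "?g r -` A r \<inter> space borel \<in> sets borel" by (rule measurable_sets[rotated]) measurable
    then show "?g r -` A r \<in> sets std_normal" by simp
  qed simp
  also have "Pi\<^sub>E {..<p} (\<lambda>r. ?g r -` A r) = ?F -` Pi\<^sub>E {..<p} A \<inter> space (row_law p)"
    by (auto simp: row_law_def space_PiM PiE_iff)
  also have "emeasure (row_law p) \<dots> = emeasure (distr (row_law p) (row_law p) ?F) (Pi\<^sub>E {..<p} A)"
    using box by (rule emeasure_distr[OF F, symmetric])
  finally show "emeasure ?D (Pi\<^sub>E {..<p} A) = emeasure (distr (row_law p) (row_law p) ?F) (Pi\<^sub>E {..<p} A)" .
next
  interpret row: prob_space "row_law p" by (rule prob_space_row_law)
  show "range (\<lambda>_::nat. space (\<Pi>\<^sub>M r\<in>{..<p}. std_normal)) \<subseteq> prod_algebra {..<p} (\<lambda>_. std_normal)"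
    by (auto simp: space_PiM intro!: prod_algebraI_finite)
  have "emeasure ?D (space (row_law p)) = (\<integral>\<^sup>+w. ennreal (row_kernel \<rho> p z w) \<partial>row_law p)"
    unfolding row_kernel_def
    by (subst emeasure_density) (auto intro!: nn_integral_cong measurable_compose[OF _ measurable_ennreal] borel_measurable_prod measurable_corr_kernel)
  then show "emeasure ?D (space (\<Pi>\<^sub>M r\<in>{..<p}. std_normal)) \<noteq> \<infinity>"
    using nn_integral_row_kernel[OF r] by (simp add: row_law_def)
qed (auto simp: row_law_def)

lemma distr_std_normal_scale: "distr std_normal borel (\<lambda>y. c * y) = normal_law 0 (c\<^sup>2)"
proof (rule normal_law_eqI)
  interpret prob_space std_normal by (rule prob_space_std_normal)
  show "prob_space (distr std_normal borel (\<lambda>y. c * y))" by (rule prob_space_distr) simp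
  fix t
  have "char (distr std_normal borel (\<lambda>y. c * y)) t = char std_normal (t * c)"
    unfolding char_def by (subst integral_distr) (auto simp: mult_ac)
  also have "\<dots> = iexp (t * 0) * complex_of_real (exp (- (c\<^sup>2 * t\<^sup>2) / 2))"
    by (subst char_normal_law) (auto simp: power_mult_distrib mult.commute)
  finally show "char (distr std_normal borel (\<lambda>y. c * y)) t = \<dots>" .
qed auto

lemma distr_std_rows_linear:
  "distr (std_rows n p) borel (\<lambda>x. \<Sum>er\<in>{..<n} \<times> {..<p}. c er * x (fst er) (snd er)) =
    normal_law 0 (\<Sum>er\<in>{..<n} \<times> {..<p}. (c er)\<^sup>2)"
proof -
  have row: "distr (row_law p) borel (\<lambda>z. \<Sum>r<p. c (e, r) * z r) = normal_law 0 (\<Sum>r<p. (c (e, r))\<^sup>2)" for e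
    using distr_PiM_sum_normal_law[of "{..<p}" "\<lambda>_. std_normal" "\<lambda>r y. c (e, r) * y" "\<lambda>r. (c (e, r))\<^sup>2" "\<lambda>_. 0"]
    by (simp add: row_law_def prob_space_std_normal distr_std_normal_scale)
  have "distr (std_rows n p) borel (\<lambda>x. \<Sum>e<n. \<Sum>r<p. c (e, r) * x e r) =
      normal_law 0 (\<Sum>e<n. \<Sum>r<p. (c (e, r))\<^sup>2)"
    using distr_PiM_sum_normal_law[of "{..<n}" "\<lambda>_. row_law p" "\<lambda>e z. \<Sum>r<p. c (e, r) * z r"
        "\<lambda>e. \<Sum>r<p. (c (e, r))\<^sup>2" "\<lambda>_. 0"]
    by (simp add: std_rows_def prob_space_row_law row sum_nonneg)
  then show ?thesis by (simp add: sum.cartesian_product split_beta)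
qed

definition data_map ::
  "nat \<Rightarrow> nat \<Rightarrow> real vec \<Rightarrow> (nat \<Rightarrow> nat \<Rightarrow> real) \<Rightarrow> (nat \<Rightarrow> nat \<Rightarrow> real) \<Rightarrow> nat \<times> nat \<Rightarrow> real" where
  "data_map n p \<mu> B x = (\<lambda>ik\<in>{..<n} \<times> {..<p}. \<mu> $ snd ik + (\<Sum>r<p. B (snd ik) r * x (fst ik) r))"

lemma measurable_data_map[measurable]: "data_map n p \<mu> B \<in> std_rows n p \<rightarrow>\<^sub>M data_space n p"
  unfolding data_map_def[abs_def] data_space_def
  by (intro measurable_restrict borel_measurable_add borel_measurable_sum borel_measurable_times
      borel_measurable_const std_rows_entry) auto

text \<open>With \<open>\<Sigma> = B B\<^sup>T\<close> and \<open>\<Psi> = W W\<^sup>T\<close>, the matrix normal law is the law of the standard normal rows mixed by \<open>W\<close>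
across observations and by \<open>B\<close> within each observation.\<close>
lemma matrix_normal_eq_distr:
  assumes \<Sigma>: "\<And>k l. k < p \<Longrightarrow> l < p \<Longrightarrow> \<Sigma> $$ (k, l) = (\<Sum>r<p. B k r * B l r)"
    and \<Psi>: "\<And>a b. a < n \<Longrightarrow> b < n \<Longrightarrow> \<Psi> $$ (a, b) = (\<Sum>e<n. W a e * W b e)"
  shows "matrix_normal n p \<mu> \<Sigma> \<Psi> = distr (std_rows n p) (data_space n p)
     (\<lambda>x. data_map n p \<mu> B (\<lambda>a r. \<Sum>e<n. W a e * x e r))"
proof -
  have "matrix_normal n p \<mu> \<Sigma> \<Psi> =
    distr (std_rows n p) (\<Pi>\<^sub>M i\<in>{..<n} \<times> {..<p}. borel)
      (\<lambda>x. \<lambda>i\<in>{..<n} \<times> {..<p}. (case i of (i, k) \<Rightarrow> \<mu> $ k) +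
        (\<Sum>er\<in>{..<n} \<times> {..<p}. (W (fst i) (fst er) * B (snd i) (snd er)) * x (fst er) (snd er)))"
    unfolding matrix_normal_def
  proof (rule gaussian_law_linear_image[OF _ _ prob_space_std_rows _ distr_std_rows_linear])
    fix ik jl :: "nat \<times> nat" assume "ik \<in> {..<n} \<times> {..<p}" "jl \<in> {..<n} \<times> {..<p}"
    then have "(case ik of (i, k) \<Rightarrow> \<lambda>(j, l). \<Psi> $$ (i, j) * \<Sigma> $$ (k, l)) jl =
        (\<Sum>e<n. W (fst ik) e * W (fst jl) e) * (\<Sum>r<p. B (snd ik) r * B (snd jl) r)"
      by (auto simp: \<Sigma> \<Psi>)
    also have "\<dots> = (\<Sum>er\<in>{..<n} \<times> {..<p}. W (fst ik) (fst er) * B (snd ik) (snd er) *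
         (W (fst jl) (fst er) * B (snd jl) (snd er)))"
      by (subst sum_product) (simp add: sum.cartesian_product split_beta mult_ac)
    finally show "(case ik of (i, k) \<Rightarrow> \<lambda>(j, l). \<Psi> $$ (i, j) * \<Sigma> $$ (k, l)) jl = \<dots>" .
  qed (auto intro!: std_rows_entry)
  also have "(\<lambda>x. \<lambda>i\<in>{..<n} \<times> {..<p}. (case i of (i, k) \<Rightarrow> \<mu> $ k) +
        (\<Sum>er\<in>{..<n} \<times> {..<p}. (W (fst i) (fst er) * B (snd i) (snd er)) * x (fst er) (snd er))) =
     (\<lambda>x. data_map n p \<mu> B (\<lambda>a r. \<Sum>e<n. W a e * x e r))"
  proof (intro ext)
    fix x and ik :: "nat \<times> nat"
    obtain i k where ik: "ik = (i, k)" by (cases ik)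
    have "(\<Sum>er\<in>{..<n} \<times> {..<p}. (W i (fst er) * B k (snd er)) * x (fst er) (snd er)) =
        (\<Sum>e<n. \<Sum>r<p. B k r * (W i e * x e r))"
      by (simp add: sum.cartesian_product split_beta mult_ac)
    also have "\<dots> = (\<Sum>r<p. B k r * (\<Sum>e<n. W i e * x e r))"
      unfolding sum_distrib_left by (rule sum.swap)
    finally show "(\<lambda>i\<in>{..<n} \<times> {..<p}. (case i of (i, k) \<Rightarrow> \<mu> $ k) +
        (\<Sum>er\<in>{..<n} \<times> {..<p}. (W (fst i) (fst er) * B (snd i) (snd er)) * x (fst er) (snd er))) ik =
       data_map n p \<mu> B (\<lambda>a r. \<Sum>e<n. W a e * x e r) ik"
      by (simp add: data_map_def ik restrict_def)
  qed
  finally show ?thesis by (simp add: data_space_def)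
qed

section \<open>One correlated pair of observations\<close>

definition pair_corr_mat :: "nat \<Rightarrow> nat \<Rightarrow> nat \<Rightarrow> real \<Rightarrow> real mat" where
  "pair_corr_mat n i j \<rho> = mat n n (\<lambda>(a, b).
     (if a = b then 1 else 0) + (if a = i \<and> b = j then \<rho> else 0) + (if a = j \<and> b = i then \<rho> else 0))"

lemma pair_corr_mat_entry:
  "a < n \<Longrightarrow> b < n \<Longrightarrow> pair_corr_mat n i j \<rho> $$ (a, b) =
     (if a = b then 1 else 0) + (if a = i \<and> b = j then \<rho> else 0) + (if a = j \<and> b = i then \<rho> else 0)"
  by (simp add: pair_corr_mat_def)

lemma sum_if_conj:
  fixes f :: "nat \<Rightarrow> real"
  assumes "finite A"
  shows "(\<Sum>b\<in>A. if P \<and> b = j then f b else 0) = (if P \<and> j \<in> A then f j else 0)"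
  using assms by (cases P) auto

text \<open>The quadratic form is \<open>\<Sum> v\<^sub>a\<^sup>2 + 2 \<rho> v\<^sub>i v\<^sub>j\<close>, and \<open>2 \<bar>v\<^sub>i v\<^sub>j\<bar> \<le> v\<^sub>i\<^sup>2 + v\<^sub>j\<^sup>2\<close>.\<close>
lemma positive_definite_pair_corr_mat:
  assumes ij: "i < j" "j < n" and r: "\<bar>\<rho>\<bar> < 1"
  shows "positive_definite_mat n (pair_corr_mat n i j \<rho>)"
  unfolding positive_definite_mat_def
proof (intro conjI ballI impI)
  show "pair_corr_mat n i j \<rho> \<in> carrier_mat n n" by (simp add: pair_corr_mat_def)
  show "transpose_mat (pair_corr_mat n i j \<rho>) = pair_corr_mat n i j \<rho>"
  proof (rule eq_matI)
    fix a b assume "a < dim_row (pair_corr_mat n i j \<rho>)" "b < dim_col (pair_corr_mat n i j \<rho>)"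
    then have "a < n" "b < n" by (simp_all add: pair_corr_mat_def)
    moreover have "transpose_mat (pair_corr_mat n i j \<rho>) $$ (a, b) = pair_corr_mat n i j \<rho> $$ (b, a)"
      using \<open>a < n\<close> \<open>b < n\<close> by (simp add: pair_corr_mat_def)
    ultimately show "transpose_mat (pair_corr_mat n i j \<rho>) $$ (a, b) = pair_corr_mat n i j \<rho> $$ (a, b)"
      unfolding pair_corr_mat_entry[OF \<open>a < n\<close> \<open>b < n\<close>] pair_corr_mat_entry[OF \<open>b < n\<close> \<open>a < n\<close>]
      by (simp only: conj_commute[of "b = i"] conj_commute[of "b = j"] eq_commute[of b a] ac_simps)
  qed (simp_all add: pair_corr_mat_def)
  fix v :: "real vec" assume v: "v \<in> carrier_vec n" "v \<noteq> 0\<^sub>v n"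
  have row: "(\<Sum>b<n. pair_corr_mat n i j \<rho> $$ (a, b) * v $ b) =
      v $ a + (if a = i then \<rho> * v $ j else 0) + (if a = j then \<rho> * v $ i else 0)" if "a < n" for a
  proof -
    have scale: "(if P then x else 0) * y = (if P then x * y else 0)" for P and x y :: real
      by simp
    have "(\<Sum>b<n. pair_corr_mat n i j \<rho> $$ (a, b) * v $ b) =
       (\<Sum>b<n. (if a = b then v $ b else 0) + (if a = i \<and> b = j then \<rho> * v $ b else 0)
         + (if a = j \<and> b = i then \<rho> * v $ b else 0))"
    proof (rule sum.cong[OF refl])
      fix b assume "b \<in> {..<n}"
      then have "b < n" by simp
      show "pair_corr_mat n i j \<rho> $$ (a, b) * v $ b = (if a = b then v $ b else 0)
          + (if a = i \<and> b = j then \<rho> * v $ b else 0) + (if a = j \<and> b = i then \<rho> * v $ b else 0)"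
        unfolding pair_corr_mat_entry[OF that \<open>b < n\<close>] distrib_right scale mult_1 ..
    qed
    also have "\<dots> = (\<Sum>b<n. if a = b then v $ b else 0) + (\<Sum>b<n. if a = i \<and> b = j then \<rho> * v $ b else 0)
         + (\<Sum>b<n. if a = j \<and> b = i then \<rho> * v $ b else 0)"
      by (simp only: sum.distrib)
    also have "\<dots> = v $ a + (if a = i then \<rho> * v $ j else 0) + (if a = j then \<rho> * v $ i else 0)"
      unfolding sum_if_conj[OF finite_lessThan] using that ij by simp
    finally show ?thesis .
  qed
  have "v \<bullet> (pair_corr_mat n i j \<rho> *\<^sub>v v) = (\<Sum>a<n. v $ a * (\<Sum>b<n. pair_corr_mat n i j \<rho> $$ (a, b) * v $ b))"
    using v by (simp add: scalar_prod_def atLeast0LessThan pair_corr_mat_def)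
  also have "\<dots> = (\<Sum>a<n. (v $ a)\<^sup>2 + (if a = i then \<rho> * v $ i * v $ j else 0) + (if a = j then \<rho> * v $ i * v $ j else 0))"
  proof (rule sum.cong[OF refl])
    fix a assume "a \<in> {..<n}"
    then have "a < n" by simp
    show "v $ a * (\<Sum>b<n. pair_corr_mat n i j \<rho> $$ (a, b) * v $ b) =
        (v $ a)\<^sup>2 + (if a = i then \<rho> * v $ i * v $ j else 0) + (if a = j then \<rho> * v $ i * v $ j else 0)"
      unfolding row[OF \<open>a < n\<close>] using ij by (auto simp: power2_eq_square algebra_simps)
  qed
  also have "\<dots> = (\<Sum>a<n. (v $ a)\<^sup>2) + 2 * (\<rho> * v $ i * v $ j)"
    using ij by (simp add: sum.distrib)
  also have "\<dots> \<ge> (1 - \<bar>\<rho>\<bar>) * (\<Sum>a<n. (v $ a)\<^sup>2)"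
  proof -
    have "(v $ i)\<^sup>2 + (v $ j)\<^sup>2 = (\<Sum>a\<in>{i, j}. (v $ a)\<^sup>2)" using ij by simp
    also have "\<dots> \<le> (\<Sum>a<n. (v $ a)\<^sup>2)" using ij by (intro sum_mono2) auto
    finally have 1: "(v $ i)\<^sup>2 + (v $ j)\<^sup>2 \<le> (\<Sum>a<n. (v $ a)\<^sup>2)" .
    have "2 * \<bar>v $ i * v $ j\<bar> \<le> (v $ i)\<^sup>2 + (v $ j)\<^sup>2"
      using sum_squares_bound[of "\<bar>v $ i\<bar>" "\<bar>v $ j\<bar>"] by (simp add: abs_mult mult_ac)
    with 1 have "\<bar>\<rho>\<bar> * (2 * \<bar>v $ i * v $ j\<bar>) \<le> \<bar>\<rho>\<bar> * (\<Sum>a<n. (v $ a)\<^sup>2)"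
      by (intro mult_left_mono) auto
    moreover have "- (\<bar>\<rho>\<bar> * \<bar>v $ i * v $ j\<bar>) \<le> \<rho> * v $ i * v $ j"
      by (metis abs_ge_minus_self abs_mult mult.assoc neg_le_iff_le minus_le_iff)
    ultimately show ?thesis by (simp add: algebra_simps)
  qed
  finally have ge: "(1 - \<bar>\<rho>\<bar>) * (\<Sum>a<n. (v $ a)\<^sup>2) \<le> v \<bullet> (pair_corr_mat n i j \<rho> *\<^sub>v v)" .
  obtain a where a: "a < n" "v $ a \<noteq> 0" using v by (metis carrier_vecD eq_vecI index_zero_vec)
  then have "0 < (\<Sum>a<n. (v $ a)\<^sup>2)" by (intro sum_pos2[of _ a]) auto
  then show "0 < v \<bullet> (pair_corr_mat n i j \<rho> *\<^sub>v v)" using ge r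
    by (meson diff_gt_0_iff_gt less_le_trans mult_pos_pos)
qed

text \<open>The rows \<open>i\<close> and \<open>j\<close> have off-diagonal sum \<open>\<rho>\<close> each, and all off-diagonal entries together \<open>2 \<rho>\<close>.\<close>
lemma d_entry_pair_corr_mat:
  assumes ij: "i < j" "j < n"
  shows "d_entry n (pair_corr_mat n i j \<rho>) i j =
    \<rho> * (1 - 2 / real n - 2 / (real n ^ 2 * (real n - 1)))"
proof -
  have off: "(\<Sum>b\<in>{..<n} - {a}. pair_corr_mat n i j \<rho> $$ (a, b)) =
      (if a = i then \<rho> else 0) + (if a = j then \<rho> else 0)" if "a < n" for a
  proof -
    have "(\<Sum>b\<in>{..<n} - {a}. pair_corr_mat n i j \<rho> $$ (a, b)) =
      (\<Sum>b\<in>{..<n} - {a}. (if a = i \<and> b = j then \<rho> else 0) + (if a = j \<and> b = i then \<rho> else 0))"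
      using that by (intro sum.cong refl) (auto simp: pair_corr_mat_entry)
    then show ?thesis using ij by (auto simp: sum.distrib sum_if_conj)
  qed
  have "(\<Sum>k<n. \<Sum>l\<in>{..<n} - {k}. pair_corr_mat n i j \<rho> $$ (k, l)) =
      (\<Sum>k<n. (if k = i then \<rho> else 0) + (if k = j then \<rho> else 0))"
    by (intro sum.cong refl off) simp
  then have tot: "(\<Sum>k<n. \<Sum>l\<in>{..<n} - {k}. pair_corr_mat n i j \<rho> $$ (k, l)) = 2 * \<rho>"
    using ij by (simp add: sum.distrib)
  have "pair_corr_mat n i j \<rho> $$ (i, j) = \<rho>" using ij by (simp add: pair_corr_mat_entry)
  then show ?thesis using ij unfolding d_entry_def tot
    by (simp add: off algebra_simps)
qed

lemma pair_corr_mat_in_alternatives: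
  assumes ij: "i < j" "j < n" and r: "\<bar>\<rho>\<bar> < 1"
    and \<delta>: "\<delta> * sqrt (ln (real n) / real p) \<le> \<rho> * (1 - 2 / real n - 2 / (real n ^ 2 * (real n - 1)))"
  shows "pair_corr_mat n i j \<rho> \<in> alternatives n p \<delta>"
proof -
  let ?S = "{\<bar>d_entry n (pair_corr_mat n i j \<rho>) a b\<bar> | a b. a < b \<and> b < n}"
  have "?S \<subseteq> (\<lambda>(a, b). \<bar>d_entry n (pair_corr_mat n i j \<rho>) a b\<bar>) ` ({..<n} \<times> {..<n})"
    by fastforce
  then have "finite ?S" by (rule finite_subset) simp
  then have "\<bar>d_entry n (pair_corr_mat n i j \<rho>) i j\<bar> \<le> d_max n (pair_corr_mat n i j \<rho>)"
    unfolding d_max_def using ij by (intro Max_ge) auto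
  then have "\<delta> * sqrt (ln (real n) / real p) \<le> d_max n (pair_corr_mat n i j \<rho>)"
    using \<delta> unfolding d_entry_pair_corr_mat[OF ij] by linarith
  moreover have "pair_corr_mat n i j \<rho> $$ (a, a) = 1" if "a < n" for a
    using that ij by (auto simp: pair_corr_mat_entry)
  ultimately show ?thesis
    unfolding alternatives_def using positive_definite_pair_corr_mat[OF ij r] by auto
qed

lemma null_hypothesis_one_mat: "null_hypothesis n (1\<^sub>m n)"
proof -
  have "v \<bullet> (1\<^sub>m n *\<^sub>v v) \<ge> 0" if "v \<in> carrier_vec n" for v :: "real vec"
    using that by (simp add: scalar_prod_def sum_nonneg)
  then show ?thesis by (auto simp: null_hypothesis_def covariance_mat_def transpose_one)
qed

lemma matrix_normal_one_mat:
  assumes \<Sigma>: "\<And>k l. k < p \<Longrightarrow> l < p \<Longrightarrow> \<Sigma> $$ (k, l) = (\<Sum>r<p. B k r * B l r)"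
  shows "matrix_normal n p \<mu> \<Sigma> (1\<^sub>m n) = distr (std_rows n p) (data_space n p) (data_map n p \<mu> B)"
proof -
  have "matrix_normal n p \<mu> \<Sigma> (1\<^sub>m n) = distr (std_rows n p) (data_space n p)
     (\<lambda>x. data_map n p \<mu> B (\<lambda>a r. \<Sum>e<n. (if a = e then 1 else 0) * x e r))"
    by (rule matrix_normal_eq_distr[OF \<Sigma>])
      (auto simp: if_distrib[of "\<lambda>u. u * _"] cong: if_cong)
  also have "(\<lambda>x. data_map n p \<mu> B (\<lambda>a r. \<Sum>e<n. (if a = e then 1 else 0) * x e r)) = data_map n p \<mu> B"
    unfolding data_map_def by (intro ext restrict_ext)
      (auto simp: if_distrib[of "\<lambda>u. u * _"] cong: if_cong)
  finally show ?thesis .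
qed

text \<open>Replacing row \<open>j\<close> by \<open>\<rho>\<close> times row \<open>i\<close> plus \<open>s = sqrt (1 - \<rho>\<^sup>2)\<close> times row \<open>j\<close> produces the correlation; the
corresponding mixing matrix \<open>W\<close> is the lower triangular factor of \<open>pair_corr_mat\<close>. Performing this
replacement amounts to tilting the null law by the row kernel.\<close>
lemma matrix_normal_pair_corr_mat:
  assumes \<Sigma>: "\<And>k l. k < p \<Longrightarrow> l < p \<Longrightarrow> \<Sigma> $$ (k, l) = (\<Sum>r<p. B k r * B l r)"
    and ij: "i < j" "j < n" and r: "\<bar>\<rho>\<bar> < 1"
  shows "matrix_normal n p \<mu> \<Sigma> (pair_corr_mat n i j \<rho>) =
    distr (density (std_rows n p) (\<lambda>x. ennreal (row_kernel \<rho> p (x i) (x j)))) (data_space n p) (data_map n p \<mu> B)"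
proof -
  define s where "s = sqrt (1 - \<rho>\<^sup>2)"
  have s2: "s * s = 1 - \<rho> * \<rho>"
    using r abs_square_less_1[of \<rho>] by (simp add: s_def flip: power2_eq_square)
  define W where "W a e = (if a = j then (if e = i then \<rho> else 0) + (if e = j then s else 0)
      else if e = a then 1 else 0)" for a e
  define T where "T z w = (\<lambda>r\<in>{..<p}. \<rho> * z r + s * w r)" for z w :: "nat \<Rightarrow> real"
  define F where "F x = (\<lambda>a\<in>{..<n}. if a = j then T (x i) (x j) else x a)" for x :: "nat \<Rightarrow> nat \<Rightarrow> real"
  have Tm: "case_prod T \<in> row_law p \<Otimes>\<^sub>M row_law p \<rightarrow>\<^sub>M row_law p"
  proof -
    have "(\<lambda>zw. \<lambda>r\<in>{..<p}. \<rho> * fst zw r + s * snd zw r) \<in> row_law p \<Otimes>\<^sub>M row_law p \<rightarrow>\<^sub>M (\<Pi>\<^sub>M r\<in>{..<p}. std_normal)"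
    proof (rule measurable_restrict)
      fix r assume "r \<in> {..<p}"
      then have [measurable]: "(\<lambda>zw. fst zw r) \<in> borel_measurable (row_law p \<Otimes>\<^sub>M row_law p)"
         "(\<lambda>zw. snd zw r) \<in> borel_measurable (row_law p \<Otimes>\<^sub>M row_law p)"
        by (auto intro!: row_law_component[of r p fst] row_law_component[of r p snd])
      have "(\<lambda>zw. \<rho> * fst zw r + s * snd zw r) \<in> borel_measurable (row_law p \<Otimes>\<^sub>M row_law p)"
        by measurable
      then show "(\<lambda>zw. \<rho> * fst zw r + s * snd zw r) \<in> row_law p \<Otimes>\<^sub>M row_law p \<rightarrow>\<^sub>M std_normal"
        by (simp cong: measurable_cong_sets)
    qed
    then show ?thesis by (simp add: T_def[abs_def] split_beta' row_law_def)
  qed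
  have Qm: "case_prod (\<lambda>z w. ennreal (row_kernel \<rho> p z w)) \<in> borel_measurable (row_law p \<Otimes>\<^sub>M row_law p)"
    unfolding split_beta by measurable
  have dens: "density (std_rows n p) (\<lambda>x. ennreal (row_kernel \<rho> p (x i) (x j))) = distr (std_rows n p) (std_rows n p) F"
    unfolding std_rows_def F_def[abs_def] using ij density_row_kernel[OF r]
    by (intro density_PiM_pair_kernel[OF prob_space_row_law _ _ _ _ Qm Tm]) (auto simp: T_def[abs_def] s_def)
  have Fm: "F \<in> std_rows n p \<rightarrow>\<^sub>M std_rows n p"
  proof -
    have "(\<lambda>x. (x i, x j)) \<in> std_rows n p \<rightarrow>\<^sub>M row_law p \<Otimes>\<^sub>M row_law p"
      using ij by (intro measurable_Pair std_rows_component) auto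
    from measurable_compose[OF this Tm] have "(\<lambda>x. T (x i) (x j)) \<in> std_rows n p \<rightarrow>\<^sub>M row_law p" by simp
    then have "(\<lambda>x. if a = j then T (x i) (x j) else x a) \<in> std_rows n p \<rightarrow>\<^sub>M row_law p" if "a < n" for a
      using that by (cases "a = j") (auto intro: std_rows_component)
    then have "(\<lambda>x. \<lambda>a\<in>{..<n}. if a = j then T (x i) (x j) else x a) \<in> std_rows n p \<rightarrow>\<^sub>M (\<Pi>\<^sub>M a\<in>{..<n}. row_law p)"
      by (intro measurable_restrict) auto
    then show ?thesis by (simp add: F_def[abs_def] std_rows_def)
  qed
  have WW: "(\<Sum>e<n. W a e * f e) = (if a = j then \<rho> * f i + s * f j else f a)" if "a < n" for a and f :: "nat \<Rightarrow> real"
    using that ij by (auto simp: W_def ring_distribs sum.distrib if_distrib[of "\<lambda>u. u * _"] cong: if_cong)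
  have "matrix_normal n p \<mu> \<Sigma> (pair_corr_mat n i j \<rho>) = distr (std_rows n p) (data_space n p)
     (\<lambda>x. data_map n p \<mu> B (\<lambda>a r. \<Sum>e<n. W a e * x e r))"
  proof (rule matrix_normal_eq_distr[OF \<Sigma>])
    fix a b assume "a < n" "b < n"
    then show "pair_corr_mat n i j \<rho> $$ (a, b) = (\<Sum>e<n. W a e * W b e)"
      using ij s2 by (simp add: WW pair_corr_mat_entry) (auto simp: W_def)
  qed
  also have "(\<lambda>x. data_map n p \<mu> B (\<lambda>a r. \<Sum>e<n. W a e * x e r)) = (\<lambda>x. data_map n p \<mu> B (F x))"
    unfolding data_map_def F_def T_def
    by (intro ext restrict_ext arg_cong2[where f = "(+)"] sum.cong refl) (auto simp: WW)
  also have "distr (std_rows n p) (data_space n p) (\<lambda>x. data_map n p \<mu> B (F x)) =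
     distr (distr (std_rows n p) (std_rows n p) F) (data_space n p) (data_map n p \<mu> B)"
    by (subst distr_distr[OF measurable_data_map Fm]) (simp add: comp_def)
  finally show ?thesis unfolding dens .
qed

text \<open>Markov's bound for the mass of the likelihood ratio above the level \<open>K\<close>: its moment of order \<open>1 + \<theta>\<close>
divided by \<open>K powr \<theta>\<close>.\<close>
definition tail_bound :: "real \<Rightarrow> nat \<Rightarrow> real \<Rightarrow> real \<Rightarrow> real" where
  "tail_bound \<rho> p \<theta> K =
     ((1 - \<rho>\<^sup>2) powr (- \<theta> / 2) * (1 - \<theta>\<^sup>2 * \<rho>\<^sup>2) powr (- 1 / 2)) ^ p * K powr (- \<theta>)"

lemma row_kernel_tail:
  assumes r: "\<bar>\<rho>\<bar> < 1" and th: "0 \<le> \<theta>" "\<theta> \<le> 1" and K: "K > 0" and ij: "i < j" "j < n"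
  shows "(\<integral>\<^sup>+x. ennreal (row_kernel \<rho> p (x i) (x j)) * indicator {x. K < row_kernel \<rho> p (x i) (x j)} x \<partial>std_rows n p)
     \<le> ennreal (tail_bound \<rho> p \<theta> K)"
proof -
  define L where "L z w = row_kernel \<rho> p z w" for z w
  have L: "L z w > 0" for z w unfolding L_def by (rule row_kernel_pos[OF r])
  have Lm: "case_prod (\<lambda>z w. ennreal (L z w powr (1 + \<theta>))) \<in> borel_measurable (row_law p \<Otimes>\<^sub>M row_law p)"
    unfolding L_def split_beta by measurable
  have bound: "ennreal (L z w) \<le> ennreal (L z w powr (1 + \<theta>)) * ennreal (K powr (- \<theta>))"
    if "K < L z w" for z w
  proof -
    \<comment> \<open>Markov's inequality, applied pointwise: above \<open>K\<close> the factor \<open>(L / K) powr \<theta>\<close> is at least 1.\<close>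
    have "1 \<le> (L z w / K) powr \<theta>" using that K th by (intro ge_one_powr_ge_zero) auto
    then have "L z w * 1 \<le> L z w * (L z w / K) powr \<theta>"
      using L[of z w] by (intro mult_left_mono) auto
    also have "\<dots> = L z w powr (1 + \<theta>) * K powr (- \<theta>)"
      using L[of z w] K by (simp add: powr_add powr_divide powr_minus_divide)
    finally show ?thesis
      by (subst ennreal_mult[symmetric]) (auto intro: ennreal_leI)
  qed
  have "(\<integral>\<^sup>+x. ennreal (L (x i) (x j)) * indicator {x. K < L (x i) (x j)} x \<partial>std_rows n p)
     \<le> (\<integral>\<^sup>+x. ennreal (L (x i) (x j) powr (1 + \<theta>)) * ennreal (K powr (- \<theta>)) \<partial>std_rows n p)"
    by (intro nn_integral_mono) (auto simp: indicator_def intro: bound)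
  also have "\<dots> = (\<integral>\<^sup>+x. ennreal (L (x i) (x j) powr (1 + \<theta>)) \<partial>std_rows n p) * ennreal (K powr (- \<theta>))"
    unfolding std_rows_def using ij by (intro nn_integral_multc measurable_PiM_pair[OF Lm]) auto
  also have "(\<integral>\<^sup>+x. ennreal (L (x i) (x j) powr (1 + \<theta>)) \<partial>std_rows n p) =
      (\<integral>\<^sup>+z. \<integral>\<^sup>+w. ennreal (L z w powr (1 + \<theta>)) \<partial>row_law p \<partial>row_law p)"
    unfolding std_rows_def using ij by (intro nn_integral_PiM_pair[OF prob_space_row_law _ _ _ _ Lm]) auto
  also have "\<dots> * ennreal (K powr (- \<theta>)) = ennreal (tail_bound \<rho> p \<theta> K)"
    unfolding L_def nn_integral_row_kernel_powr[OF r th] tail_bound_def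
    by (subst ennreal_mult) auto
  finally show ?thesis by (simp add: L_def)
qed

text \<open>The event \<open>A\<close> that the test rejects is pulled back to the standard normal rows. There the null law is a
fixed measure, the alternatives are its tiltings by \<open>L\<close>, and the pair with the least power does at least
as badly for the test as the average pair.\<close>
lemma exists_alternative_with_small_power:
  assumes T: "T \<in> level_tests \<alpha> n p \<mu> \<Sigma>" and cov: "covariance_mat p \<Sigma>" and n: "n \<ge> 2"
    and r: "\<bar>\<rho>\<bar> < 1" and th: "0 \<le> \<theta>" "\<theta> \<le> 1" and K: "K > 0"
    and \<delta>: "\<delta> * sqrt (ln (real n) / real p) \<le> \<rho> * (1 - 2 / real n - 2 / (real n ^ 2 * (real n - 1)))"
  shows "\<exists>\<Psi>\<in>alternatives n p \<delta>. rejection_prob n p \<mu> \<Sigma> \<Psi> T \<le>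
    \<alpha> + tail_bound \<rho> p \<theta> K + sqrt (2 * tail_bound \<rho> p \<theta> K + K / (real n * (real n - 1) / 2))"
proof -
  obtain B where B: "\<And>k l. k < p \<Longrightarrow> l < p \<Longrightarrow> \<Sigma> $$ (k, l) = (\<Sum>r<p. B k r * B l r)"
    using covariance_mat_factor[OF cov] by blast
  define J where "J = {(i, j). i < j \<and> j < n}"
  define L where "L ij x = row_kernel \<rho> p (x (fst ij)) (x (snd ij))" for ij and x :: "nat \<Rightarrow> nat \<Rightarrow> real"
  define R where "R = {X \<in> space (data_space n p). T X = 1}"
  define A where "A = data_map n p \<mu> B -` R \<inter> space (std_rows n p)"
  interpret P: prob_space "std_rows n p" by (rule prob_space_std_rows)
  have Tm: "T \<in> data_space n p \<rightarrow>\<^sub>M count_space {0, 1}" using T by (simp add: level_tests_def)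
  have R: "R \<in> sets (data_space n p)"
  proof -
    have "R = T -` {1} \<inter> space (data_space n p)" by (auto simp: R_def)
    then show ?thesis using measurable_sets[OF Tm, of "{1}"] by simp
  qed
  have A: "A \<in> sets (std_rows n p)" unfolding A_def by (rule measurable_sets[OF measurable_data_map R])
  have J_sub: "J \<subseteq> {..<n} \<times> {..<n}" by (auto simp: J_def)
  then have finJ: "finite J" by (rule finite_subset) simp
  have "(0, 1) \<in> J" using n by (simp add: J_def)
  then have neJ: "J \<noteq> {}" by blast
  have cardJ: "real (card J) = real n * (real n - 1) / 2"
  proof -
    have "J = (\<Union>j\<in>{..<n}. (\<lambda>i. (i, j)) ` {..<j})" by (auto simp: J_def)
    then have "card J = (\<Sum>j<n. card ((\<lambda>i. (i, j)) ` {..<j}))"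
      by (simp add: card_UN_disjoint) (subst card_UN_disjoint, auto)
    also have "\<dots> = (\<Sum>j<n. j)" by (simp add: card_image inj_on_def)
    finally have "card J = (\<Sum>j<n. j)" .
    moreover have "real (\<Sum>j<m. j) = real m * (real m - 1) / 2" for m
      by (induction m) (auto simp: field_simps)
    ultimately show ?thesis by simp
  qed
  have Q: "case_prod (\<lambda>z w. ennreal (row_kernel \<rho> p z w)) \<in> borel_measurable (row_law p \<Otimes>\<^sub>M row_law p)"
    unfolding split_beta by measurable
  have rej: "rejection_prob n p \<mu> \<Sigma> (pair_corr_mat n (fst ij) (snd ij) \<rho>) T =
     measure (density (std_rows n p) (\<lambda>x. ennreal (L ij x))) A" if "ij \<in> J" for ij
  proof -
    have lt: "fst ij < snd ij" "snd ij < n" using that by (auto simp: J_def)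
    have 1: "matrix_normal n p \<mu> \<Sigma> (pair_corr_mat n (fst ij) (snd ij) \<rho>) =
        distr (density (std_rows n p) (\<lambda>x. ennreal (row_kernel \<rho> p (x (fst ij)) (x (snd ij)))))
          (data_space n p) (data_map n p \<mu> B)"
      by (rule matrix_normal_pair_corr_mat[OF _ lt r]) (rule B)
    show ?thesis unfolding rejection_prob_def 1 R_def[symmetric] L_def A_def
      using R by (subst measure_distr) auto
  qed
  have rej0: "measure (std_rows n p) A \<le> \<alpha>"
  proof -
    have "rejection_prob n p \<mu> \<Sigma> (1\<^sub>m n) T \<le> \<alpha>"
      using T null_hypothesis_one_mat by (auto simp: level_tests_def)
    moreover have "matrix_normal n p \<mu> \<Sigma> (1\<^sub>m n) = distr (std_rows n p) (data_space n p) (data_map n p \<mu> B)"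
      by (rule matrix_normal_one_mat) (rule B)
    then have "rejection_prob n p \<mu> \<Sigma> (1\<^sub>m n) T = measure (std_rows n p) A"
      unfolding rejection_prob_def R_def[symmetric] A_def
      using R by (simp add: measure_distr)
    ultimately show ?thesis by simp
  qed
  let ?\<eta> = "tail_bound \<rho> p \<theta> K"
  have "(\<Sum>ij\<in>J. measure (density (std_rows n p) (\<lambda>x. ennreal (L ij x))) A) / card J
     \<le> measure (std_rows n p) A + ?\<eta> + sqrt (2 * ?\<eta> + K / card J)"
  proof (rule P.average_density_measure_le[OF finJ neJ])
    fix ij assume ij: "ij \<in> J"
    then have lt: "fst ij < snd ij" "snd ij < n" by (auto simp: J_def)
    show "L ij \<in> borel_measurable (std_rows n p)"
      unfolding L_def[abs_def] using lt by (intro measurable_row_kernel std_rows_component) auto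
    show "0 \<le> L ij x" for x unfolding L_def using row_kernel_pos[OF r] less_imp_le by blast
    show "(\<integral>\<^sup>+x. ennreal (L ij x) \<partial>std_rows n p) = 1"
      using nn_integral_PiM_integrate_out[of "row_law p" "{..<n}" "fst ij" "snd ij" _ "\<lambda>_. 1", OF prob_space_row_law _ _ _ _ Q]
        lt nn_integral_row_kernel[OF r] P.emeasure_space_1
      by (simp add: L_def std_rows_def)
    show "(\<integral>\<^sup>+x. ennreal (L ij x) * indicator {x. K < L ij x} x \<partial>std_rows n p) \<le> ennreal ?\<eta>"
      unfolding L_def by (rule row_kernel_tail[OF r th K lt])
    fix kl assume kl: "kl \<in> J" and ne: "ij \<noteq> kl"
    then have "fst kl < snd kl" "snd kl < n" by (auto simp: J_def)
    moreover have "{fst ij, snd ij} \<noteq> {fst kl, snd kl}"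
      using ne lt calculation by (auto simp: doubleton_eq_iff prod_eq_iff)
    ultimately have "(\<integral>\<^sup>+x. ennreal (L ij x) * ennreal (L kl x) \<partial>std_rows n p) = 1"
      unfolding L_def std_rows_def using lt
      by (intro nn_integral_PiM_two_pairs[OF prob_space_row_law _ _ _ _ _ _ _ _ Q])
        (auto simp: row_kernel_commute[of \<rho> p] nn_integral_row_kernel[OF r])
    then show "(\<integral>\<^sup>+x. ennreal (L ij x) * ennreal (L kl x) \<partial>std_rows n p) \<le> 1" by simp
  qed (use K A in \<open>auto simp: tail_bound_def\<close>)
  also have "\<dots> \<le> \<alpha> + ?\<eta> + sqrt (2 * ?\<eta> + K / card J)" (is "_ \<le> ?b") using rej0 by simp
  finally have avg: "(\<Sum>ij\<in>J. rejection_prob n p \<mu> \<Sigma> (pair_corr_mat n (fst ij) (snd ij) \<rho>) T) \<le> ?b * card J"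
    using finJ neJ by (simp add: rej divide_le_eq card_gt_0_iff)
  have "\<exists>ij\<in>J. rejection_prob n p \<mu> \<Sigma> (pair_corr_mat n (fst ij) (snd ij) \<rho>) T \<le> ?b"
  proof (rule ccontr)
    assume "\<not> ?thesis"
    then have "(\<Sum>ij\<in>J. ?b) < (\<Sum>ij\<in>J. rejection_prob n p \<mu> \<Sigma> (pair_corr_mat n (fst ij) (snd ij) \<rho>) T)"
      by (intro sum_strict_mono finJ neJ) auto
    with avg show False by (simp add: mult.commute)
  qed
  then obtain ij where ij: "ij \<in> J" "rejection_prob n p \<mu> \<Sigma> (pair_corr_mat n (fst ij) (snd ij) \<rho>) T \<le> ?b" by blast
  then have "pair_corr_mat n (fst ij) (snd ij) \<rho> \<in> alternatives n p \<delta>"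
    by (intro pair_corr_mat_in_alternatives r \<delta>) (auto simp: J_def)
  with ij(2) show ?thesis unfolding cardJ by blast
qed

section \<open>Asymptotics\<close>

lemma neg_ln_one_minus_le:
  fixes x :: real
  assumes "x < 1"
  shows "- ln (1 - x) \<le> x / (1 - x)"
proof -
  have "- ln (1 - x) = ln (1 / (1 - x))" using assms by (simp add: ln_div)
  also have "\<dots> \<le> 1 / (1 - x) - 1" using assms by (intro ln_le_minus_one) simp
  also have "\<dots> = x / (1 - x)" using assms by (simp add: field_simps)
  finally show ?thesis .
qed

text \<open>Since \<open>p \<rho>\<^sup>2\<close> will be about \<open>\<delta>\<^sup>2 ln n\<close> and \<open>\<rho>\<close> small, the exponent compares \<open>(1 + \<theta>) \<delta>\<^sup>2 / 2\<close> times \<open>ln n\<close> with \<open>ln K\<close>.\<close>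
lemma tail_bound_le:
  assumes th: "0 \<le> \<theta>" "\<theta> \<le> 1" and r: "\<rho>\<^sup>2 < 1" and K: "K > 0"
  shows "tail_bound \<rho> p \<theta> K \<le> exp (\<theta> * ((1 + \<theta>) / 2 * (real p * \<rho>\<^sup>2 / (1 - \<rho>\<^sup>2)) - ln K))"
proof -
  have le: "\<theta>\<^sup>2 * \<rho>\<^sup>2 \<le> \<rho>\<^sup>2" using th by (simp add: mult_left_le_one_le power_le_one)
  with r have lt: "\<theta>\<^sup>2 * \<rho>\<^sup>2 < 1" by linarith
  have 1: "- ln (1 - \<rho>\<^sup>2) \<le> \<rho>\<^sup>2 / (1 - \<rho>\<^sup>2)" using r by (rule neg_ln_one_minus_le)
  have "- ln (1 - \<theta>\<^sup>2 * \<rho>\<^sup>2) \<le> \<theta>\<^sup>2 * \<rho>\<^sup>2 / (1 - \<theta>\<^sup>2 * \<rho>\<^sup>2)" using lt by (rule neg_ln_one_minus_le)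
  also have "\<dots> \<le> \<theta>\<^sup>2 * \<rho>\<^sup>2 / (1 - \<rho>\<^sup>2)" using le r by (intro divide_left_mono) auto
  finally have 2: "- ln (1 - \<theta>\<^sup>2 * \<rho>\<^sup>2) \<le> \<theta>\<^sup>2 * \<rho>\<^sup>2 / (1 - \<rho>\<^sup>2)" .
  have "tail_bound \<rho> p \<theta> K =
      exp (real p * (\<theta> / 2 * - ln (1 - \<rho>\<^sup>2) + 1 / 2 * - ln (1 - \<theta>\<^sup>2 * \<rho>\<^sup>2)) - \<theta> * ln K)"
  proof -
    have "(1 - \<rho>\<^sup>2) powr (- \<theta> / 2) * (1 - \<theta>\<^sup>2 * \<rho>\<^sup>2) powr (- 1 / 2) =
        exp (\<theta> / 2 * - ln (1 - \<rho>\<^sup>2) + 1 / 2 * - ln (1 - \<theta>\<^sup>2 * \<rho>\<^sup>2))"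
      using r lt by (simp add: powr_def exp_add[symmetric] mult_exp_exp)
    moreover have "K powr (- \<theta>) = exp (- (\<theta> * ln K))" using K by (simp add: powr_def)
    ultimately show ?thesis
      unfolding tail_bound_def by (simp only: exp_of_nat_mult[symmetric] mult_exp_exp diff_conv_add_uminus)
  qed
  also have "\<dots> \<le> exp (real p * (\<theta> / 2 * (\<rho>\<^sup>2 / (1 - \<rho>\<^sup>2)) + 1 / 2 * (\<theta>\<^sup>2 * \<rho>\<^sup>2 / (1 - \<rho>\<^sup>2))) - \<theta> * ln K)"
    unfolding exp_le_cancel_iff using 1 2 th
    by (intro diff_right_mono mult_left_mono add_mono) auto
  also have "real p * (\<theta> / 2 * (\<rho>\<^sup>2 / (1 - \<rho>\<^sup>2)) + 1 / 2 * (\<theta>\<^sup>2 * \<rho>\<^sup>2 / (1 - \<rho>\<^sup>2))) - \<theta> * ln K =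
      \<theta> * ((1 + \<theta>) / 2 * (real p * \<rho>\<^sup>2 / (1 - \<rho>\<^sup>2)) - ln K)"
    unfolding times_divide_eq_right[symmetric] by (simp add: power2_eq_square[of \<theta>] algebra_simps add_divide_distrib)
  finally show ?thesis .
qed

theorem theorem2p6:
  fixes \<alpha> \<beta> c \<epsilon> \<tau> \<delta> :: real
    and p :: "nat \<Rightarrow> nat"
    and \<mu> :: "nat \<Rightarrow> real vec"
    and \<Sigma> :: "nat \<Rightarrow> real mat"
  assumes "\<alpha> > 0" and "\<beta> > 0" and "\<alpha> + \<beta> < 1"
    and "c > 0" and "\<And>n. n \<ge> 1 \<Longrightarrow> real (p n) > c * real n"
    and "\<epsilon> > 0" and "0 < \<tau>" and "\<tau> < 2"
    and "(\<lambda>n. ln (real (p n))) \<in> o(\<lambda>n. real n powr min (1 - \<epsilon>) (2 / \<tau> - 1))"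
    and "\<And>n. n \<ge> 1 \<Longrightarrow> \<mu> n \<in> carrier_vec (p n)"
    and "\<And>n. n \<ge> 1 \<Longrightarrow> covariance_mat (p n) (\<Sigma> n)"
    and "0 < \<delta>" and "\<delta> < 2"
  shows "limsup (\<lambda>n. SUP T\<in>level_tests \<alpha> n (p n) (\<mu> n) (\<Sigma> n).
                     INF \<Psi>\<in>alternatives n (p n) \<delta>.
                       ereal (rejection_prob n (p n) (\<mu> n) (\<Sigma> n) \<Psi> T))
           \<le> ereal (1 - \<beta>)"
proof -
  note c = assms(4) and pn = assms(5) and cov = assms(11)
  have \<delta>2: "0 < \<delta>\<^sup>2" "\<delta>\<^sup>2 < 4"
    using assms(12,13) abs_le_square_iff[of 2 \<delta>] by auto
  \<comment> \<open>This choice gives \<open>(1 + \<theta>) \<delta>\<^sup>2 \<le> (4 + \<delta>\<^sup>2) / 2 < 4\<close>, which leaves room for \<open>\<kappa>\<close> below 2.\<close>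
  define \<theta> where "\<theta> = min 1 ((4 - \<delta>\<^sup>2) / (2 * \<delta>\<^sup>2))"
  have th: "0 < \<theta>" "\<theta> \<le> 1" using \<delta>2 by (auto simp: \<theta>_def)
  define h where "h = (1 + \<theta>) * \<delta>\<^sup>2 / 2"
  have h2: "h < 2"
  proof -
    have "\<theta> * \<delta>\<^sup>2 \<le> (4 - \<delta>\<^sup>2) / (2 * \<delta>\<^sup>2) * \<delta>\<^sup>2"
      using \<delta>2 by (intro mult_right_mono) (auto simp: \<theta>_def)
    also have "\<dots> = (4 - \<delta>\<^sup>2) / 2" using \<delta>2 by simp
    finally show ?thesis using \<delta>2 by (simp add: h_def ring_distribs)
  qed
  then obtain \<kappa> where \<kappa>: "h < \<kappa>" "\<kappa> < 2" using dense by blast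
  define g where "g n = 1 - 2 / real n - 2 / (real n ^ 2 * (real n - 1))" for n :: nat
  define \<rho> where "\<rho> n = \<delta> * sqrt (ln (real n) / real (p n)) / g n" for n
  \<comment> \<open>\<open>t n\<close> bounds the tail mass above the level \<open>n powr \<kappa>\<close>, and \<open>k n\<close> is that level divided by the number of pairs.\<close>
  define t where "t n = exp (\<theta> * (((1 + \<theta>) / 2 * (\<delta>\<^sup>2 / (g n)\<^sup>2 / (1 - (\<rho> n)\<^sup>2)) - \<kappa>) * ln (real n)))" for n
  define k where "k n = real n powr \<kappa> / (real n * (real n - 1) / 2)" for n :: nat
  have g: "g \<longlonglongrightarrow> 1" unfolding g_def by real_asymp
  have lnp: "(\<lambda>n. ln (real n) / real (p n)) \<longlonglongrightarrow> 0"
  proof (rule tendsto_sandwich[OF _ _ tendsto_const])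
    show "\<forall>\<^sub>F n in sequentially. 0 \<le> ln (real n) / real (p n)"
      using eventually_ge_at_top[of 1] by eventually_elim simp
    show "\<forall>\<^sub>F n in sequentially. ln (real n) / real (p n) \<le> ln (real n) / (c * real n)"
      using eventually_ge_at_top[of 1]
    proof eventually_elim
      case (elim n)
      then have "0 < c * real n" using c by simp
      moreover have "c * real n < real (p n)" using pn elim by simp
      ultimately show ?case using elim
        by (intro frac_le) auto
    qed
    show "(\<lambda>n. ln (real n) / (c * real n)) \<longlonglongrightarrow> 0" using c by real_asymp
  qed
  have rsq: "(\<rho> n)\<^sup>2 = \<delta>\<^sup>2 * (ln (real n) / real (p n)) / (g n)\<^sup>2" if "n \<ge> 1" for n
    using that by (simp add: \<rho>_def power_divide power_mult_distrib)
  have r0: "(\<lambda>n. (\<rho> n)\<^sup>2) \<longlonglongrightarrow> 0"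
  proof (rule Lim_transform_eventually)
    show "(\<lambda>n. \<delta>\<^sup>2 * (ln (real n) / real (p n)) / (g n)\<^sup>2) \<longlonglongrightarrow> 0"
      using tendsto_divide[OF tendsto_mult[OF tendsto_const[of "\<delta>\<^sup>2"] lnp] tendsto_power[OF g, of 2]] by simp
    show "\<forall>\<^sub>F n in sequentially. \<delta>\<^sup>2 * (ln (real n) / real (p n)) / (g n)\<^sup>2 = (\<rho> n)\<^sup>2"
      using eventually_ge_at_top[of 1] by eventually_elim (simp add: rsq)
  qed
  have t0: "t \<longlonglongrightarrow> 0"
  proof -
    have lim: "(\<lambda>n. \<theta> * ((1 + \<theta>) / 2 * (\<delta>\<^sup>2 / (g n)\<^sup>2 / (1 - (\<rho> n)\<^sup>2)) - \<kappa>)) \<longlonglongrightarrow>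
        \<theta> * ((1 + \<theta>) / 2 * (\<delta>\<^sup>2 / 1\<^sup>2 / (1 - 0)) - \<kappa>)"
      by (intro tendsto_intros g r0) auto
    have "(1 + \<theta>) / 2 * (\<delta>\<^sup>2 / 1\<^sup>2 / (1 - 0)) - \<kappa> < 0" using \<kappa> by (simp add: h_def)
    then have neg: "\<theta> * ((1 + \<theta>) / 2 * (\<delta>\<^sup>2 / 1\<^sup>2 / (1 - 0)) - \<kappa>) < 0"
      using th by (simp add: mult_pos_neg)
    have "filterlim (\<lambda>n. ln (real n)) at_top sequentially" by real_asymp
    from filterlim_compose[OF exp_at_bot filterlim_tendsto_neg_mult_at_bot[OF lim neg this]]
    show ?thesis by (simp add: t_def[abs_def] mult.assoc)
  qed
  have k0: "k \<longlonglongrightarrow> 0"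
  proof -
    have "(\<lambda>n. real n powr (\<kappa> - 2) * (2 * real n ^ 2 / (real n * (real n - 1)))) \<longlonglongrightarrow> 0 * 2"
    proof (rule tendsto_mult)
      show "(\<lambda>n. real n powr (\<kappa> - 2)) \<longlonglongrightarrow> 0"
        using \<kappa> by (intro tendsto_neg_powr filterlim_real_sequentially) simp
      show "(\<lambda>n. 2 * real n ^ 2 / (real n * (real n - 1))) \<longlonglongrightarrow> 2" by real_asymp
    qed
    moreover have "\<forall>\<^sub>F n in sequentially. real n powr (\<kappa> - 2) * (2 * real n ^ 2 / (real n * (real n - 1))) = k n"
      using eventually_ge_at_top[of 2]
    proof eventually_elim
      case (elim n)
      then have "real n powr (\<kappa> - 2) = real n powr \<kappa> / real n ^ 2"
        by (simp add: powr_diff)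
      then show ?case using elim by (simp add: k_def)
    qed
    ultimately show ?thesis using Lim_transform_eventually by fastforce
  qed
  have "(\<lambda>n. \<alpha> + t n + sqrt (2 * t n + k n)) \<longlonglongrightarrow> \<alpha> + 0 + sqrt (2 * 0 + 0)"
    by (intro tendsto_intros t0 k0)
  then have small: "\<forall>\<^sub>F n in sequentially. \<alpha> + t n + sqrt (2 * t n + k n) < 1 - \<beta>"
    by (rule order_tendstoD) (use assms(3) in simp)
  have g_pos: "\<forall>\<^sub>F n in sequentially. g n > 0" using g by (rule order_tendstoD) simp
  have r_small: "\<forall>\<^sub>F n in sequentially. (\<rho> n)\<^sup>2 < 1" using r0 by (rule order_tendstoD) simp
  show ?thesis
  proof (rule Limsup_bounded)
    show "\<forall>\<^sub>F n in sequentially. (SUP T\<in>level_tests \<alpha> n (p n) (\<mu> n) (\<Sigma> n).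
       INF \<Psi>\<in>alternatives n (p n) \<delta>. ereal (rejection_prob n (p n) (\<mu> n) (\<Sigma> n) \<Psi> T)) \<le> ereal (1 - \<beta>)"
      using small g_pos r_small eventually_ge_at_top[of 2]
    proof eventually_elim
      case (elim n)
      define b where "b = tail_bound (\<rho> n) (p n) \<theta> (real n powr \<kappa>)"
      have "0 < c * real n" using c elim by simp
      also have "\<dots> < real (p n)" using pn elim by simp
      finally have "real (p n) * (\<rho> n)\<^sup>2 = \<delta>\<^sup>2 / (g n)\<^sup>2 * ln (real n)" using elim by (simp add: rsq)
      moreover have "b \<le> exp (\<theta> * ((1 + \<theta>) / 2 * (real (p n) * (\<rho> n)\<^sup>2 / (1 - (\<rho> n)\<^sup>2)) - ln (real n powr \<kappa>)))"
        unfolding b_def using th elim by (intro tail_bound_le) auto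
      ultimately have b: "b \<le> t n"
        using elim by (simp add: t_def ln_powr algebra_simps)
      have bd: "\<alpha> + b + sqrt (2 * b + k n) \<le> 1 - \<beta>"
      proof -
        have "sqrt (2 * b + k n) \<le> sqrt (2 * t n + k n)" using b by simp
        then show ?thesis using b elim by linarith
      qed
      show ?case
      proof (rule SUP_least)
        fix T assume "T \<in> level_tests \<alpha> n (p n) (\<mu> n) (\<Sigma> n)"
        moreover have "\<delta> * sqrt (ln (real n) / real (p n)) \<le> \<rho> n * (1 - 2 / real n - 2 / (real n ^ 2 * (real n - 1)))"
          using elim unfolding g_def[symmetric] \<rho>_def by simp
        ultimately have "\<exists>\<Psi>\<in>alternatives n (p n) \<delta>. rejection_prob n (p n) (\<mu> n) (\<Sigma> n) \<Psi> T \<le> \<alpha> + b + sqrt (2 * b + k n)"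
          unfolding b_def k_def using elim cov[of n] th
          by (intro exists_alternative_with_small_power) (auto simp: abs_square_less_1)
        then obtain \<Psi> where "\<Psi> \<in> alternatives n (p n) \<delta>" "rejection_prob n (p n) (\<mu> n) (\<Sigma> n) \<Psi> T \<le> 1 - \<beta>"
          using bd by (meson order_trans)
        then show "(INF \<Psi>\<in>alternatives n (p n) \<delta>. ereal (rejection_prob n (p n) (\<mu> n) (\<Sigma> n) \<Psi> T)) \<le> ereal (1 - \<beta>)"
          by (intro INF_lower2) auto
      qed
    qed
  qed
qed

end
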